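(* Let $\rho_1,\rho_2\in\mathrm{Alg}(G_n)$ be non-zero. Then $\rho_1\otimes\rho_2\subset(\rho_1\times\rho_2)_{N,\psi}$ (that is, $\rho_1\otimes\rho_2$ is isomorphic to a $\Delta G_n$-submodule of $(\rho_1\times\rho_2)_{N,\psi}$), and consequently $(\rho_1\times\rho_2)_{N,\psi}$ is non-zero.
   Context: $F$ is a non-archimedean local field or a finite field, $\mathcal M_n$ is the space of $n\times n$ matrices over $F$, $G_n=GL_n(F)$, and $\mathrm{Alg}(G)$ is the category of smooth complex representations of $G$. $\rho_1\times\rho_2$ is the normalized parabolically induced representation of $G_{2n}$ from the standard block upper triangular parabolic $P_{n,n}$ with Levi $G_n\times G_n$, i.e. right translation on smooth functions $f$ with $f(pg)=\delta_{P_{n,n}}^{1/2}(p)(\rho_1\otimes\rho_2)(p)f(g)$, where $\rho_1\otimes\rho_2$ is extended trivially on $N$ (modular characters are trivial if $F$ is finite). $N=\left\{\begin{pmatrix} I_n&x\\0&I_n\end{pmatrix}:x\in\mathcal M_n\right\}$, $\psi_0$ is a fixed non-trivial additive character of $F$, $\psi\begin{pmatrix} I_n&x\\0&I_n\end{pmatrix}=\psi_0(\mathrm{tr}(x))$; $\Delta G_n=\left\{\begin{pmatrix}g&0\\0&g\end{pmatrix}:g\in G_n\right\}$. For a smooth representation $(\pi,V)$ of $G_{2n}$, $\pi_{N,\psi}$ is the natural representation of $\Delta G_n$ on $V/\langle\pi(u)v-\psi(u)v:u\in N,v\in V\rangle$. $\rho_1\otimes\rho_2$ as a $\Delta G_n$-module: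 $\begin{pmatrix}g&0\\0&g\end{pmatrix}$ acts by $\rho_1(g)\otimes\rho_2(g)$. *)

theory Defs
  imports
    "HOL-Analysis.Analysis"
    "HOL-Library.Poly_Mapping"
    "HOL-Library.Function_Algebras"
    "HOL-Library.Set_Algebras"
begin

section \<open>Complex vector spaces\<close>

class scaleC =
  fixes scaleC :: "complex \<Rightarrow> 'a \<Rightarrow> 'a"  (infixr \<open>*\<^sub>C\<close> 75)

class complex_vector = scaleC + ab_group_add +
  assumes scaleC_add_right: "a *\<^sub>C (x + y) = a *\<^sub>C x + a *\<^sub>C y"
    and scaleC_add_left: "(a + b) *\<^sub>C x = a *\<^sub>C x + b *\<^sub>C x"
    and scaleC_scaleC: "a *\<^sub>C b *\<^sub>C x = (a * b) *\<^sub>C x"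
    and scaleC_one: "1 *\<^sub>C x = x"

global_interpretation complex_vector: vector_space "scaleC :: complex \<Rightarrow> 'a \<Rightarrow> 'a::complex_vector"
  by unfold_locales (simp_all add: scaleC_add_right scaleC_add_left scaleC_scaleC scaleC_one)

abbreviation clinear :: "('a::complex_vector \<Rightarrow> 'b::complex_vector) \<Rightarrow> bool"
  where "clinear \<equiv> Vector_Spaces.linear scaleC scaleC"

instantiation "fun" :: (type, complex_vector) complex_vector
begin
definition scaleC_fun_def: "c *\<^sub>C f = (\<lambda>x. c *\<^sub>C f x)"
instance
  by standard
    (simp_all add: scaleC_fun_def plus_fun_def scaleC_add_right scaleC_add_left scaleC_scaleC scaleC_one)
end

instantiation complex :: complex_vector
begin
definition scaleC_complex_def: "c *\<^sub>C (x::complex) = c * x"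
instance by standard (simp_all add: scaleC_complex_def algebra_simps)
end

instantiation poly_mapping :: (type, complex_vector) complex_vector
begin
lift_definition scaleC_poly_mapping :: "complex \<Rightarrow> ('a \<Rightarrow>\<^sub>0 'b) \<Rightarrow> ('a \<Rightarrow>\<^sub>0 'b)"
  is "\<lambda>c f x. c *\<^sub>C f x"
  by (rule finite_subset) auto
instance
  by standard
    (transfer, simp add: fun_eq_iff scaleC_add_right scaleC_add_left scaleC_scaleC scaleC_one)+
end

section \<open>Tensor products\<close>

text \<open>
  The tensor product over the complex numbers: the free vector space on the set of pairs, modulo
  the span of the bilinearity relations.
\<close>

definition tensor_relations :: "(('v::complex_vector \<times> 'w::complex_vector) \<Rightarrow>\<^sub>0 complex) set" where
  "tensor_relations =
     {Poly_Mapping.single (v + v', w) 1 - Poly_Mapping.single (v, w) 1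
        - Poly_Mapping.single (v', w) 1 | v v' w. True} \<union>
     {Poly_Mapping.single (v, w + w') 1 - Poly_Mapping.single (v, w) 1
        - Poly_Mapping.single (v, w') 1 | v w w'. True} \<union>
     {Poly_Mapping.single (c *\<^sub>C v, w) 1 - c *\<^sub>C Poly_Mapping.single (v, w) 1 | c v w. True} \<union>
     {Poly_Mapping.single (v, c *\<^sub>C w) 1 - c *\<^sub>C Poly_Mapping.single (v, w) 1 | c v w. True}"

definition tensor_rel ::
  "(('v::complex_vector \<times> 'w::complex_vector) \<Rightarrow>\<^sub>0 complex) \<Rightarrow> (('v \<times> 'w) \<Rightarrow>\<^sub>0 complex) \<Rightarrow> bool" where
  "tensor_rel p q \<longleftrightarrow> p - q \<in> complex_vector.span tensor_relations"

lemma equivp_tensor_rel: "equivp tensor_rel"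
proof (rule equivpI)
  show "reflp tensor_rel"
    by (auto simp: reflp_def tensor_rel_def complex_vector.span_zero)
  show "symp tensor_rel"
    unfolding symp_def tensor_rel_def
    using complex_vector.span_neg by fastforce
  show "transp tensor_rel"
    unfolding transp_def tensor_rel_def
    using complex_vector.span_add by fastforce
qed

quotient_type (overloaded) ('v, 'w) tensor =
  "('v::complex_vector \<times> 'w::complex_vector) \<Rightarrow>\<^sub>0 complex" / tensor_rel
  by (rule equivp_tensor_rel)

instantiation tensor :: (complex_vector, complex_vector) complex_vector
begin
lift_definition zero_tensor :: "('a, 'b) tensor" is 0 .
lift_definition plus_tensor :: "('a, 'b) tensor \<Rightarrow> ('a, 'b) tensor \<Rightarrow> ('a, 'b) tensor" is "(+)"
  unfolding tensor_rel_def by (drule (1) complex_vector.span_add) (simp add: algebra_simps)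
lift_definition uminus_tensor :: "('a, 'b) tensor \<Rightarrow> ('a, 'b) tensor" is uminus
  unfolding tensor_rel_def by (drule complex_vector.span_neg) (simp add: algebra_simps)
lift_definition minus_tensor :: "('a, 'b) tensor \<Rightarrow> ('a, 'b) tensor \<Rightarrow> ('a, 'b) tensor" is "(-)"
  unfolding tensor_rel_def by (drule (1) complex_vector.span_diff) (simp add: algebra_simps)
lift_definition scaleC_tensor :: "complex \<Rightarrow> ('a, 'b) tensor \<Rightarrow> ('a, 'b) tensor" is scaleC
  unfolding tensor_rel_def
  by (simp flip: complex_vector.scale_right_diff_distrib add: complex_vector.span_scale)
instance
proof
  fix a b c :: "('a, 'b) tensor" and x y :: complex
  have [simp]: "tensor_rel p p" for p :: "('a \<times> 'b) \<Rightarrow>\<^sub>0 complex"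
    using equivp_tensor_rel by (rule equivp_reflp)
  show "a + b + c = a + (b + c)" by transfer (simp add: add.assoc)
  show "a + b = b + a" by transfer (simp add: add.commute)
  show "0 + a = a" by transfer simp
  show "- a + a = 0" by transfer simp
  show "a - b = a + - b" by transfer simp
  show "x *\<^sub>C (a + b) = x *\<^sub>C a + x *\<^sub>C b" by transfer (simp add: scaleC_add_right)
  show "(x + y) *\<^sub>C a = x *\<^sub>C a + y *\<^sub>C a" by transfer (simp add: scaleC_add_left)
  show "x *\<^sub>C y *\<^sub>C a = (x * y) *\<^sub>C a" by transfer (simp add: scaleC_scaleC)
  show "1 *\<^sub>C a = a" by transfer (simp add: scaleC_one)
qed
end

lift_definition pure_tensor :: "'v::complex_vector \<Rightarrow> 'w::complex_vector \<Rightarrow> ('v, 'w) tensor"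
  is "\<lambda>v w. Poly_Mapping.single (v, w) 1" .

definition tensor_map ::
  "('v::complex_vector \<Rightarrow> 'v'::complex_vector) \<Rightarrow> ('w::complex_vector \<Rightarrow> 'w'::complex_vector) \<Rightarrow>
    ('v, 'w) tensor \<Rightarrow> ('v', 'w') tensor" where
  "tensor_map f g t =
     (\<Sum>(v, w) \<in> Poly_Mapping.keys (rep_tensor t).
        Poly_Mapping.lookup (rep_tensor t) (v, w) *\<^sub>C pure_tensor (f v) (g w))"

text \<open>
  The definition of \<^const>\<open>tensor_map\<close> evaluates on a chosen representative. For linear arguments
  this choice is immaterial: \<open>clinear_tensor_map\<close> and \<open>tensor_map_pure\<close> below identify it as the
  usual tensor product of linear maps.
\<close>

lemma pure_tensor_add_left: "pure_tensor (v + v') w = pure_tensor v w + pure_tensor v' w"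
proof transfer
  fix v v' :: 'a and w :: 'b
  have "Poly_Mapping.single (v + v', w) (1::complex) - Poly_Mapping.single (v, w) 1
      - Poly_Mapping.single (v', w) 1 \<in> complex_vector.span tensor_relations"
    unfolding tensor_relations_def by (rule complex_vector.span_base) blast
  then show "tensor_rel (Poly_Mapping.single (v + v', w) 1)
      (Poly_Mapping.single (v, w) 1 + Poly_Mapping.single (v', w) 1)"
    by (simp only: tensor_rel_def diff_diff_add)
qed

lemma pure_tensor_add_right: "pure_tensor v (w + w') = pure_tensor v w + pure_tensor v w'"
proof transfer
  fix v :: 'a and w w' :: 'b
  have "Poly_Mapping.single (v, w + w') (1::complex) - Poly_Mapping.single (v, w) 1
      - Poly_Mapping.single (v, w') 1 \<in> complex_vector.span tensor_relations"
    unfolding tensor_relations_def by (rule complex_vector.span_base) blast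
  then show "tensor_rel (Poly_Mapping.single (v, w + w') 1)
      (Poly_Mapping.single (v, w) 1 + Poly_Mapping.single (v, w') 1)"
    by (simp only: tensor_rel_def diff_diff_add)
qed

lemma pure_tensor_scaleC_left: "pure_tensor (c *\<^sub>C v) w = c *\<^sub>C pure_tensor v w"
  by transfer (unfold tensor_rel_def tensor_relations_def, rule complex_vector.span_base, blast)

lemma pure_tensor_scaleC_right: "pure_tensor v (c *\<^sub>C w) = c *\<^sub>C pure_tensor v w"
  by transfer (unfold tensor_rel_def tensor_relations_def, rule complex_vector.span_base, blast)

context
  fixes f :: "'v::complex_vector \<Rightarrow> 'x::complex_vector"
    and g :: "'w::complex_vector \<Rightarrow> 'y::complex_vector"
  assumes f: "clinear f" and g: "clinear g"
begin

private definition ext :: "(('v \<times> 'w) \<Rightarrow>\<^sub>0 complex) \<Rightarrow> ('x, 'y) tensor" where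
  "ext p = (\<Sum>k \<in> Poly_Mapping.keys p.
     Poly_Mapping.lookup p k *\<^sub>C pure_tensor (f (fst k)) (g (snd k)))"

private lemma ext_superset:
  assumes "finite A" "Poly_Mapping.keys p \<subseteq> A"
  shows "ext p = (\<Sum>k \<in> A. Poly_Mapping.lookup p k *\<^sub>C pure_tensor (f (fst k)) (g (snd k)))"
  unfolding ext_def
  by (rule sum.mono_neutral_left) (use assms in \<open>auto simp: in_keys_iff\<close>)

private lemma ext_add: "ext (p + q) = ext p + ext q"
proof -
  let ?A = "Poly_Mapping.keys p \<union> Poly_Mapping.keys q"
  have "ext (p + q) = (\<Sum>k \<in> ?A. Poly_Mapping.lookup (p + q) k *\<^sub>C pure_tensor (f (fst k)) (g (snd k)))"
    by (rule ext_superset) (auto simp: Poly_Mapping.keys_add)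
  also have "\<dots> = ext p + ext q"
    by (subst (1 2) ext_superset[where A = ?A])
      (auto simp: lookup_add scaleC_add_left sum.distrib)
  finally show ?thesis .
qed

private lemma lookup_scaleC: "Poly_Mapping.lookup (c *\<^sub>C p) k = c * Poly_Mapping.lookup p k"
  for p :: "'z \<Rightarrow>\<^sub>0 complex"
  by transfer (simp add: scaleC_complex_def)

private lemma ext_scaleC: "ext (c *\<^sub>C p) = c *\<^sub>C ext p"
proof -
  have "ext (c *\<^sub>C p) = (\<Sum>k \<in> Poly_Mapping.keys p.
      Poly_Mapping.lookup (c *\<^sub>C p) k *\<^sub>C pure_tensor (f (fst k)) (g (snd k)))"
    by (rule ext_superset) (auto simp: in_keys_iff lookup_scaleC)
  then show ?thesis
    by (simp add: ext_def lookup_scaleC complex_vector.scale_sum_right scaleC_scaleC)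
qed

private lemma clinear_ext: "clinear ext"
  by (auto intro!: Vector_Spaces.linear_iff[THEN iffD2]
      complex_vector.vector_space_axioms simp: ext_add ext_scaleC)

private lemma ext_single: "ext (Poly_Mapping.single (v, w) 1) = pure_tensor (f v) (g w)"
  by (simp add: ext_def scaleC_one)

private lemma ext_diff: "ext (p - q) = ext p - ext q"
  using ext_add[of "p - q" q] by (simp add: algebra_simps)

private lemma ext_relations: "p \<in> complex_vector.span tensor_relations \<Longrightarrow> ext p = 0"
proof (induction rule: complex_vector.span_induct_alt)
  case base
  show ?case by (simp add: ext_def)
next
  case (step c x y)
  have fg: "f (v + v') = f v + f v'" "g (w + w') = g w + g w'"
      "f (c *\<^sub>C v) = c *\<^sub>C f v" "g (c *\<^sub>C w) = c *\<^sub>C g w" for v v' w w' c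
    using f g by (auto simp: Vector_Spaces.linear_iff)
  from step have "ext x = 0"
    by (auto simp: tensor_relations_def ext_diff ext_scaleC ext_single fg pure_tensor_add_left
        pure_tensor_add_right pure_tensor_scaleC_left pure_tensor_scaleC_right)
  with step show ?case by (simp add: ext_add ext_scaleC)
qed

private lemma tensor_map_abs: "tensor_map f g (abs_tensor p) = ext p"
proof -
  have "tensor_rel (rep_tensor (abs_tensor p)) p"
    using Quotient3_tensor equivp_reflp[OF equivp_tensor_rel] by (rule rep_abs_rsp_left)
  then have "ext (rep_tensor (abs_tensor p)) = ext p"
    unfolding tensor_rel_def by (auto dest!: ext_relations simp: ext_diff)
  then show ?thesis by (simp add: tensor_map_def ext_def case_prod_unfold)
qed

lemma tensor_map_pure: "tensor_map f g (pure_tensor v w) = pure_tensor (f v) (g w)"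
  by (simp add: pure_tensor.abs_eq tensor_map_abs ext_single)

lemma clinear_tensor_map: "clinear (tensor_map f g)"
proof -
  have "tensor_map f g (s + t) = tensor_map f g s + tensor_map f g t" for s t
    by (induct s, induct t) (simp add: plus_tensor.abs_eq tensor_map_abs ext_add)
  moreover have "tensor_map f g (c *\<^sub>C t) = c *\<^sub>C tensor_map f g t" for c t
    by (induct t) (simp add: scaleC_tensor.abs_eq tensor_map_abs ext_scaleC)
  ultimately show ?thesis
    by (auto intro!: Vector_Spaces.linear_iff[THEN iffD2] complex_vector.vector_space_axioms)
qed

end

section \<open>Non-archimedean local fields\<close>

text \<open>
  A field with an ultrametric absolute value \<open>x \<mapsto> dist x 0\<close> that induces its metric, and thereby
  its topology. If the field is finite, every nonzero element is a root of unity, so the absolute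
  value is trivial and the topology discrete.
\<close>

class nonarch_valued_field = field + metric_space +
  assumes dist_eq_dist_diff_zero: "dist x y = dist (x - y) 0"
    and dist_mult_zero: "dist (x * y) 0 = dist x 0 * dist y 0"
    and dist_ultrametric: "dist x z \<le> max (dist x y) (dist y z)"

definition fabs :: "'a::nonarch_valued_field \<Rightarrow> real" where
  "fabs x = dist x 0"

text \<open>The cosets \<open>x + \<mm>\<close> of the maximal ideal in the valuation ring are the open unit balls
  inside the closed unit ball.\<close>

definition residue_field :: "'a::nonarch_valued_field set set" where
  "residue_field = (\<lambda>x. ball x 1) ` cball 0 1"

definition uniformizer :: "'a::nonarch_valued_field \<Rightarrow> bool" where
  "uniformizer \<pi> \<longleftrightarrow> \<pi> \<noteq> 0 \<and> fabs \<pi> < 1 \<and> (\<forall>x::'a. fabs x < 1 \<longrightarrow> fabs x \<le> fabs \<pi>)"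

text \<open>
  Complete, discretely valued, with finite residue field. The last condition normalizes the absolute
  value; it only selects one absolute value within the class defining the topology of the field.
\<close>

definition nonarch_local_field :: "'a::nonarch_valued_field itself \<Rightarrow> bool" where
  "nonarch_local_field _ \<longleftrightarrow>
     complete (UNIV :: 'a set) \<and>
     finite (residue_field :: 'a set set) \<and>
     (\<exists>\<pi>::'a. uniformizer \<pi> \<and> fabs \<pi> = 1 / real (card (residue_field :: 'a set set)))"

definition nontrivial_additive_character :: "('a::nonarch_valued_field \<Rightarrow> complex) \<Rightarrow> bool" where
  "nontrivial_additive_character \<psi> \<longleftrightarrow>
     continuous_on UNIV \<psi> \<and> (\<forall>x y. \<psi> (x + y) = \<psi> x * \<psi> y) \<and> (\<forall>x. cmod (\<psi> x) = 1) \<and>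
     (\<exists>x. \<psi> x \<noteq> 1)"

section \<open>Smooth representations of general linear groups\<close>

definition GL :: "('a::field ^ 'n ^ 'n) set" where
  "GL = {A. invertible A}"

text \<open>The values of \<open>\<rho>\<close> outside \<^const>\<open>GL\<close> are irrelevant.\<close>

definition smooth_rep ::
  "('a::nonarch_valued_field ^ 'n ^ 'n \<Rightarrow> 'v::complex_vector \<Rightarrow> 'v) \<Rightarrow> bool" where
  "smooth_rep \<rho> \<longleftrightarrow>
     (\<forall>g\<in>GL. clinear (\<rho> g)) \<and>
     (\<forall>v. \<rho> (mat 1) v = v) \<and>
     (\<forall>g\<in>GL. \<forall>h\<in>GL. \<forall>v. \<rho> (g ** h) v = \<rho> g (\<rho> h v)) \<and>
     (\<forall>v. openin (top_of_set GL) {g \<in> GL. \<rho> g v = v})"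

section \<open>Parabolic induction\<close>

text \<open>Square matrices of size \<open>2n\<close> are indexed by \<^typ>\<open>'n + 'n\<close>, so the blocks are given by the
  two summands.\<close>

definition block ::
  "'a ^ 'n ^ 'n \<Rightarrow> 'a ^ 'n ^ 'n \<Rightarrow> 'a ^ 'n ^ 'n \<Rightarrow> 'a ^ 'n ^ 'n \<Rightarrow> 'a ^ ('n + 'n) ^ ('n + 'n)" where
  "block a b c d = (\<chi> i j.
     case i of
       Inl i' \<Rightarrow> (case j of Inl j' \<Rightarrow> a $ i' $ j' | Inr j' \<Rightarrow> b $ i' $ j')
     | Inr i' \<Rightarrow> (case j of Inl j' \<Rightarrow> c $ i' $ j' | Inr j' \<Rightarrow> d $ i' $ j'))"

text \<open>
  The modular character of the block upper triangular parabolic at an element with diagonal blocks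
  \<open>a\<close>, \<open>d\<close>: the absolute value of the determinant of the adjoint action \<open>x \<mapsto> a x d\<^sup>-\<^sup>1\<close> on the
  unipotent radical. It is trivial for finite fields, since \<^const>\<open>fabs\<close> is.
\<close>

definition modular_char ::
  "'a::nonarch_valued_field ^ 'n ^ 'n \<Rightarrow> 'a ^ 'n ^ 'n \<Rightarrow> real" where
  "modular_char a d = (fabs (det a) / fabs (det d)) ^ CARD('n)"

definition right_translation ::
  "'a::semiring_1 ^ 'm ^ 'm \<Rightarrow> ('a ^ 'm ^ 'm \<Rightarrow> 'v) \<Rightarrow> ('a ^ 'm ^ 'm \<Rightarrow> 'v)" where
  "right_translation h f = (\<lambda>g. f (g ** h))"

text \<open>
  The space of the normalized induced representation, on which the group acts by
  \<^const>\<open>right_translation\<close>. Functions on the group are represented by their extension by zero to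
  all matrices. Smoothness means invariance under right translation by an open subgroup.
\<close>

definition parabolic_ind ::
  "('a::nonarch_valued_field ^ 'n ^ 'n \<Rightarrow> 'v::complex_vector \<Rightarrow> 'v) \<Rightarrow>
   ('a ^ 'n ^ 'n \<Rightarrow> 'w::complex_vector \<Rightarrow> 'w) \<Rightarrow>
   ('a ^ ('n + 'n) ^ ('n + 'n) \<Rightarrow> ('v, 'w) tensor) set" where
  "parabolic_ind \<rho>1 \<rho>2 = {f.
     (\<forall>g. g \<notin> GL \<longrightarrow> f g = 0) \<and>
     (\<forall>a\<in>GL. \<forall>d\<in>GL. \<forall>x. \<forall>g\<in>GL.
        f (block a x 0 d ** g) =
          complex_of_real (sqrt (modular_char a d)) *\<^sub>C tensor_map (\<rho>1 a) (\<rho>2 d) (f g)) \<and>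
     openin (top_of_set GL) {k \<in> GL. right_translation k f = f}}"

section \<open>Twisted Jacquet modules\<close>

text \<open>
  Here \<open>\<pi>\<close> is an action on a subspace \<open>V\<close> of the ambient vector space. The quotient is the set
  of cosets of \<open>jacquet_kernel\<close>. Addition of cosets is addition of sets, and \<open>coset_scale\<close> is
  scalar multiplication; the kernel is added there because the image of a coset under \<open>0\<close> is not
  a coset.
\<close>

definition jacquet_kernel ::
  "('a::nonarch_valued_field \<Rightarrow> complex) \<Rightarrow>
   ('a ^ ('n::finite + 'n) ^ ('n + 'n) \<Rightarrow> 'u::complex_vector \<Rightarrow> 'u) \<Rightarrow> 'u set \<Rightarrow> 'u set" where
  "jacquet_kernel \<psi>0 \<pi> V = complex_vector.span
     {\<pi> (block (mat 1) x 0 (mat 1)) v - \<psi>0 (trace x) *\<^sub>C v | x v. v \<in> V}"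

definition twisted_jacquet ::
  "('a::nonarch_valued_field \<Rightarrow> complex) \<Rightarrow>
   ('a ^ ('n::finite + 'n) ^ ('n + 'n) \<Rightarrow> 'u::complex_vector \<Rightarrow> 'u) \<Rightarrow> 'u set \<Rightarrow> 'u set set" where
  "twisted_jacquet \<psi>0 \<pi> V = (\<lambda>v. v +o jacquet_kernel \<psi>0 \<pi> V) ` V"

definition coset_scale :: "'u::complex_vector set \<Rightarrow> complex \<Rightarrow> 'u set \<Rightarrow> 'u set" where
  "coset_scale K c A = scaleC c ` A + K"

definition diag_action ::
  "('a::zero ^ ('n + 'n) ^ ('n + 'n) \<Rightarrow> 'u \<Rightarrow> 'u) \<Rightarrow> 'a ^ 'n ^ 'n \<Rightarrow> 'u set \<Rightarrow> 'u set" where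
  "diag_action \<pi> g A = \<pi> (block g 0 0 g) ` A"

definition jacquet_submodule ::
  "('a::nonarch_valued_field \<Rightarrow> complex) \<Rightarrow>
   ('a ^ ('n::finite + 'n) ^ ('n + 'n) \<Rightarrow> 'u::complex_vector \<Rightarrow> 'u) \<Rightarrow> 'u set \<Rightarrow> 'u set set \<Rightarrow> bool" where
  "jacquet_submodule \<psi>0 \<pi> V W \<longleftrightarrow>
     W \<subseteq> twisted_jacquet \<psi>0 \<pi> V \<and>
     jacquet_kernel \<psi>0 \<pi> V \<in> W \<and>
     (\<forall>A\<in>W. \<forall>B\<in>W. A + B \<in> W) \<and>
     (\<forall>c. \<forall>A\<in>W. coset_scale (jacquet_kernel \<psi>0 \<pi> V) c A \<in> W) \<and>
     (\<forall>g\<in>GL. \<forall>A\<in>W. diag_action \<pi> g A \<in> W)"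

text \<open>\<open>T\<close> is an isomorphism from the representation \<open>\<sigma>\<close> onto the submodule \<open>W\<close>.\<close>

definition iso_onto_jacquet_submodule ::
  "('a::nonarch_valued_field \<Rightarrow> complex) \<Rightarrow>
   ('a ^ ('n::finite + 'n) ^ ('n + 'n) \<Rightarrow> 'u::complex_vector \<Rightarrow> 'u) \<Rightarrow> 'u set \<Rightarrow>
   ('a ^ 'n ^ 'n \<Rightarrow> 't::complex_vector \<Rightarrow> 't) \<Rightarrow> 'u set set \<Rightarrow> ('t \<Rightarrow> 'u set) \<Rightarrow> bool" where
  "iso_onto_jacquet_submodule \<psi>0 \<pi> V \<sigma> W T \<longleftrightarrow>
     jacquet_submodule \<psi>0 \<pi> V W \<and>
     bij_betw T UNIV W \<and>
     (\<forall>s t. T (s + t) = T s + T t) \<and>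
     (\<forall>c t. T (c *\<^sub>C t) = coset_scale (jacquet_kernel \<psi>0 \<pi> V) c (T t)) \<and>
     (\<forall>g\<in>GL. \<forall>t. T (\<sigma> g t) = diag_action \<pi> g (T t))"

end

theory Submission
  imports Defs
begin

text \<open>
  Let \<open>P\<close> be the block upper triangular parabolic and \<open>w\<close> the permutation of the two blocks. The
  double coset \<open>P w N\<close> is open, and \<open>N\<close> acts on \<open>P\<close>-cosets in it simply transitively. So a tensor \<open>t\<close> and
  a lattice \<open>L\<close> of matrices determine an element of the induced space: the function supported on the
  part of \<open>P w N\<close> over \<open>L\<close> with value \<open>t\<close> on it (\<open>cell_section\<close>). The embedding sends \<open>t\<close> to the class
  of this function for a fixed ball \<open>L0\<close> on which the character is trivial.

  Injectivity. The integral of \<open>\<psi>(- tr u) f(w u)\<close> over a large ball of matrices \<open>u\<close> annihilates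
  any given generator of the kernel, and on the section of \<open>t\<close> it is a positive multiple of \<open>t\<close>. Since
  \<open>f\<close> is smooth and balls are totally bounded, the integral is a finite sum over representatives of a
  large ball modulo a small one (\<open>cell_section_kernel_imp_zero\<close>).

  Equivariance. The element of \<open>\<Delta>G\<close> given by \<open>g\<close> carries the section of \<open>t\<close> over \<open>L0\<close> to the section of
  \<open>g t\<close> over \<open>g L0 g\<^sup>-\<^sup>1\<close>. Modulo the kernel a section over a lattice is the index of a smaller lattice
  times the section over the latter (\<open>cell_section_refine\<close>), so translation by \<open>g\<close> is correct up to a
  positive factor \<open>c(g)\<close>, the modulus of conjugation by \<open>g\<close> on the space of matrices. It remains to see
  that \<open>c(g) = 1\<close>. Injectivity makes \<open>c\<close> multiplicative, and transposition of lattices gives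
  \<open>c(g) = c(h)\<close> for \<open>h\<close> the inverse transpose of \<open>g\<close>. Diagonal matrices thus satisfy
  \<open>c(g) = c(g\<^sup>-\<^sup>1)\<close>, whence \<open>c(g) = 1\<close>; an elimination matrix is conjugate to its inverse by a diagonal
  matrix, so it has \<open>c(g) = 1\<close> as well; and by Gaussian elimination these matrices generate the group
  (\<open>GL_induct\<close>).
\<close>

section \<open>Matrix algebra over a field\<close>

lemma matrix_add_rdistrib: "(A + B) ** C = A ** C + B ** C"
  for A B :: "'a::semiring_1 ^ 'n ^ 'm"
  by (vector matrix_matrix_mult_def sum.distrib[symmetric] distrib_right)

lemma matrix_diff_ldistrib: "A ** (B - C) = A ** B - A ** C"
  for A :: "'a::ring_1 ^ 'n ^ 'm"
  by (vector matrix_matrix_mult_def sum_subtractf[symmetric] right_diff_distrib)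

lemma matrix_diff_rdistrib: "(A - B) ** C = A ** C - B ** C"
  for A B :: "'a::ring_1 ^ 'n ^ 'm"
  by (vector matrix_matrix_mult_def sum_subtractf[symmetric] left_diff_distrib)

lemma
  assumes "A \<in> GL"
  shows matrix_inv_right: "A ** matrix_inv A = mat 1"
    and matrix_inv_left: "matrix_inv A ** A = mat 1"
proof -
  have "\<exists>B. A ** B = mat 1 \<and> B ** A = mat 1" using assms by (auto simp: GL_def invertible_def)
  from someI_ex[OF this] show "A ** matrix_inv A = mat 1" "matrix_inv A ** A = mat 1"
    by (auto simp: matrix_inv_def)
qed

lemma GL_of_right_inverse: "A ** B = mat 1 \<Longrightarrow> A \<in> GL"
  by (auto simp: GL_def invertible_right_inverse)

lemma matrix_inv_GL: "A \<in> GL \<Longrightarrow> matrix_inv A \<in> GL"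
  by (blast intro: GL_of_right_inverse matrix_inv_left)

lemma GL_mult: "A \<in> GL \<Longrightarrow> B \<in> GL \<Longrightarrow> A ** B \<in> GL"
  by (simp add: GL_def invertible_mult)

lemma GL_mat_1 [simp]: "mat 1 \<in> GL"
  by (rule GL_of_right_inverse[of _ "mat 1"]) simp

lemma matrix_inv_mult_cancel:
  fixes A B :: "'a::field ^ 'n ^ 'n"
  assumes "A \<in> GL"
  shows "matrix_inv A ** (A ** B) = B" "A ** (matrix_inv A ** B) = B"
    "B ** A ** matrix_inv A = B" "B ** matrix_inv A ** A = B"
proof -
  note inv = matrix_inv_left[OF assms] matrix_inv_right[OF assms]
  show "matrix_inv A ** (A ** B) = B" "A ** (matrix_inv A ** B) = B"
    unfolding matrix_mul_assoc inv by simp_all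
  show "B ** A ** matrix_inv A = B" "B ** matrix_inv A ** A = B"
    unfolding matrix_mul_assoc[symmetric] inv by simp_all
qed

lemma matrix_inv_unique: "A ** B = mat 1 \<Longrightarrow> matrix_inv A = B"
  for A B :: "'a::field ^ 'n ^ 'n"
  using matrix_inv_mult_cancel(1)[of A B] GL_of_right_inverse[of A B] by simp

lemma matrix_inv_one [simp]: "matrix_inv (mat 1 :: 'a::field ^ 'n ^ 'n) = mat 1"
  by (rule matrix_inv_unique) simp

lemma matrix_inv_mult: "a \<in> GL \<Longrightarrow> b \<in> GL \<Longrightarrow> matrix_inv (a ** b) = matrix_inv b ** matrix_inv a"
  for a b :: "'a::field ^ 'n ^ 'n"
  by (rule matrix_inv_unique) (metis matrix_inv_right matrix_inv_mult_cancel(3) matrix_mul_assoc)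

lemma GL_mult_iff:
  fixes a b :: "'a::field ^ 'n ^ 'n"
  assumes "a \<in> GL"
  shows "a ** b \<in> GL \<longleftrightarrow> b \<in> GL" "b ** a \<in> GL \<longleftrightarrow> b \<in> GL"
  using assms by (auto simp: GL_def invertible_det_nz det_mul)

lemma det_GL: "A \<in> GL \<Longrightarrow> det A \<noteq> 0"
  by (simp add: GL_def invertible_det_nz)

section \<open>Ultrametric estimates for matrices\<close>

lemma fabs_zero [simp]: "fabs (0::'a::nonarch_valued_field) = 0"
  by (simp add: fabs_def)

lemma fabs_eq_zero_iff [simp]: "fabs x = 0 \<longleftrightarrow> x = (0::'a::nonarch_valued_field)"
  by (simp add: fabs_def)

lemma fabs_ge_zero [simp]: "0 \<le> fabs (x::'a::nonarch_valued_field)"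
  by (simp add: fabs_def)

lemma fabs_mult: "fabs (x * y) = fabs x * fabs (y::'a::nonarch_valued_field)"
  by (simp add: fabs_def dist_mult_zero)

lemma fabs_one [simp]: "fabs (1::'a::nonarch_valued_field) = 1"
proof -
  have "fabs (1::'a) * fabs (1::'a) = fabs (1::'a)" by (simp flip: fabs_mult)
  then show ?thesis by simp
qed

lemma fabs_minus [simp]: "fabs (- x) = fabs (x::'a::nonarch_valued_field)"
proof -
  have "fabs (-1::'a) * fabs (-1::'a) = 1" using fabs_mult[of "-1::'a" "-1"] by simp
  then have "fabs (-1::'a) = 1"
    using fabs_ge_zero[of "-1::'a"] by (metis abs_of_nonneg abs_mult_self_eq abs_one power2_eq_1_iff
        power2_eq_square abs_minus_cancel)
  then show ?thesis using fabs_mult[of "-1" x] by simp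
qed

lemma dist_eq_fabs: "dist x y = fabs (x - y)" for x y :: "'a::nonarch_valued_field"
  unfolding fabs_def by (rule dist_eq_dist_diff_zero)

lemma fabs_add_le: "fabs (x + y) \<le> max (fabs x) (fabs y)" for x y :: "'a::nonarch_valued_field"
  using dist_ultrametric[of x "- y" 0] by (simp add: dist_eq_fabs)

lemma fabs_add_bound: "fabs x \<le> r \<Longrightarrow> fabs y \<le> r \<Longrightarrow> fabs (x + y) \<le> r"
  for x y :: "'a::nonarch_valued_field"
  using fabs_add_le[of x y] by linarith

lemma fabs_diff_bound: "fabs x \<le> r \<Longrightarrow> fabs y \<le> r \<Longrightarrow> fabs (x - y) \<le> r"
  for x y :: "'a::nonarch_valued_field"
  using fabs_add_bound[of x r "- y"] by simp

lemma fabs_sum_bound: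
  "(\<And>i. i \<in> A \<Longrightarrow> fabs (f i) \<le> r) \<Longrightarrow> 0 \<le> r \<Longrightarrow> fabs (\<Sum>i\<in>A. f i) \<le> r"
  for f :: "'i \<Rightarrow> 'a::nonarch_valued_field"
  by (induction A rule: infinite_finite_induct) (auto intro: fabs_add_bound)

lemma fabs_power: "fabs (x ^ k) = fabs x ^ k" for x :: "'a::nonarch_valued_field"
  by (induction k) (auto simp: fabs_mult)

lemma fabs_divide: "fabs (x / y) = fabs x / fabs y" for x y :: "'a::nonarch_valued_field"
proof (cases "y = 0")
  case False
  then have "fabs (x / y) * fabs y = fabs x" by (simp flip: fabs_mult)
  with False show ?thesis by (simp add: field_simps)
qed simp

text \<open>
  The balls of the maximum norm. By the ultrametric inequality they are additive subgroups, and they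
  are stable under transposition.
\<close>

definition mball :: "real \<Rightarrow> ('a::nonarch_valued_field ^ 'n ^ 'm) set" where
  "mball r = {x. \<forall>i j. fabs (x $ i $ j) \<le> r}"

lemma mball_zero [simp]: "0 \<le> r \<Longrightarrow> 0 \<in> mball r"
  by (simp add: mball_def)

lemma mball_add: "x \<in> mball r \<Longrightarrow> y \<in> mball r \<Longrightarrow> x + y \<in> mball r"
  by (simp add: mball_def fabs_add_bound)

lemma mball_diff: "x \<in> mball r \<Longrightarrow> y \<in> mball r \<Longrightarrow> x - y \<in> mball r"
  by (simp add: mball_def fabs_diff_bound)

lemma mball_minus_iff [simp]: "- x \<in> mball r \<longleftrightarrow> x \<in> mball r"
  by (simp add: mball_def)

lemma mball_mono: "x \<in> mball r \<Longrightarrow> r \<le> s \<Longrightarrow> x \<in> mball s"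
  unfolding mball_def using order_trans by blast

lemma mball_transpose_iff [simp]: "transpose x \<in> mball r \<longleftrightarrow> x \<in> mball r"
  by (auto simp: mball_def transpose_def)

lemma mball_mat_1 [simp]: "mat 1 \<in> mball 1"
  by (simp add: mball_def mat_def)

lemma mball_mult:
  fixes x :: "'a::nonarch_valued_field ^ 'n ^ 'm" and y :: "'a ^ 'p ^ 'n"
  assumes "x \<in> mball r" "y \<in> mball s" "0 \<le> r" "0 \<le> s"
  shows "x ** y \<in> mball (r * s)"
  using assms unfolding mball_def matrix_matrix_mult_def
  by (auto intro!: fabs_sum_bound mult_mono simp: fabs_mult)

lemma ex_mball: "\<exists>r\<ge>1. x \<in> mball r"
proof -
  have "fabs (x $ i $ j) \<le> 1 + (\<Sum>i\<in>UNIV. \<Sum>j\<in>UNIV. fabs (x $ i $ j))" for i j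
  proof -
    have "fabs (x $ i $ j) \<le> (\<Sum>j\<in>UNIV. fabs (x $ i $ j))"
      by (rule member_le_sum) auto
    also have "\<dots> \<le> (\<Sum>i\<in>UNIV. \<Sum>j\<in>UNIV. fabs (x $ i $ j))"
      by (rule member_le_sum[where f = "\<lambda>i. \<Sum>j\<in>UNIV. fabs (x $ i $ j)"]) (auto intro: sum_nonneg)
    finally show ?thesis by simp
  qed
  then show ?thesis
    by (intro exI[of _ "1 + (\<Sum>i\<in>UNIV. \<Sum>j\<in>UNIV. fabs (x $ i $ j))"])
      (auto simp: mball_def intro!: sum_nonneg)
qed

lemma fabs_prod_le_one:
  "(\<And>i. i \<in> A \<Longrightarrow> fabs (f i) \<le> 1) \<Longrightarrow> fabs (\<Prod>i\<in>A. f i) \<le> 1"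
  for f :: "'i \<Rightarrow> 'a::nonarch_valued_field"
  by (induction A rule: infinite_finite_induct) (auto simp: fabs_mult intro: mult_le_one)

lemma fabs_prod_diff_bound:
  fixes f g :: "'i \<Rightarrow> 'a::nonarch_valued_field"
  assumes "finite A" "\<And>i. i \<in> A \<Longrightarrow> fabs (f i) \<le> 1" "\<And>i. i \<in> A \<Longrightarrow> fabs (g i) \<le> 1"
    "\<And>i. i \<in> A \<Longrightarrow> fabs (f i - g i) \<le> r" "0 \<le> r"
  shows "fabs ((\<Prod>i\<in>A. f i) - (\<Prod>i\<in>A. g i)) \<le> r"
  using assms
proof (induction A)
  case (insert a A)
  have eq: "(\<Prod>i\<in>insert a A. f i) - (\<Prod>i\<in>insert a A. g i)
      = f a * ((\<Prod>i\<in>A. f i) - (\<Prod>i\<in>A. g i)) + (f a - g a) * (\<Prod>i\<in>A. g i)"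
    using insert by (simp add: algebra_simps)
  have "fabs (f a * ((\<Prod>i\<in>A. f i) - (\<Prod>i\<in>A. g i))) \<le> 1 * r"
    unfolding fabs_mult using insert by (intro mult_mono) auto
  moreover have "fabs ((f a - g a) * (\<Prod>i\<in>A. g i)) \<le> r * 1"
    unfolding fabs_mult using insert by (intro mult_mono fabs_prod_le_one) auto
  ultimately show ?case unfolding eq by (intro fabs_add_bound) auto
qed auto

text \<open>On integral matrices no term of the Leibniz formula increases distances.\<close>

lemma fabs_det_diff_bound:
  fixes x y :: "'a::nonarch_valued_field ^ 'n ^ 'n"
  assumes "x \<in> mball 1" "y \<in> mball 1" "x - y \<in> mball r" "0 \<le> r"
  shows "fabs (det x - det y) \<le> r"
proof -
  have "fabs (of_int (sign p) * (\<Prod>i\<in>UNIV. x $ i $ p i) - of_int (sign p) * (\<Prod>i\<in>UNIV. y $ i $ p i))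
      \<le> r" for p :: "'n \<Rightarrow> 'n"
  proof -
    have "fabs (of_int (sign p) :: 'a) = 1" by (simp add: sign_def)
    moreover have "fabs ((\<Prod>i\<in>UNIV. x $ i $ p i) - (\<Prod>i\<in>UNIV. y $ i $ p i)) \<le> r"
      using assms by (intro fabs_prod_diff_bound) (auto simp: mball_def)
    ultimately show ?thesis by (simp add: fabs_mult flip: right_diff_distrib)
  qed
  then show ?thesis
    unfolding det_def sum_subtractf[symmetric] by (intro fabs_sum_bound assms) auto
qed

text \<open>
  The determinant is a polynomial with integer coefficients in the entries, so it is congruent to one
  together with the matrix; hence its absolute value is one, by the ultrametric inequality.
\<close>

lemma near_one:
  fixes x :: "'a::nonarch_valued_field ^ 'n ^ 'n"
  assumes "x - mat 1 \<in> mball r" "r < 1" "0 \<le> r"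
  shows near_one_integral: "x \<in> mball 1"
    and near_one_det: "fabs (det x) = 1"
    and near_one_GL: "x \<in> GL"
    and near_one_inverse: "matrix_inv x \<in> mball 1"
proof -
  have "x - mat 1 \<in> mball 1" using assms mball_mono by force
  from mball_add[OF this mball_mat_1] show x: "x \<in> mball 1" by simp
  have "fabs (det x - det (mat 1 :: 'a^'n^'n)) \<le> r"
    using x assms by (intro fabs_det_diff_bound) auto
  then have d: "fabs (det x - 1) < 1" using assms(2) by simp
  have "fabs (det x) \<le> 1" using fabs_add_le[of "det x - 1" 1] d by simp
  moreover have "1 \<le> fabs (det x)"
    using fabs_add_le[of "1 - det x" "det x"] d fabs_minus[of "det x - 1"] by simp
  ultimately show 1: "fabs (det x) = 1" by simp
  then have "det x \<noteq> 0" by auto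
  then show GL: "x \<in> GL" by (simp add: GL_def invertible_det_nz)
  let ?y = "matrix_inv x"
  have xy: "x ** ?y = mat 1" using GL by (rule matrix_inv_right)
  \<comment> \<open>If the norm of \<open>y = 1 - (x - 1) y\<close> exceeded one, the right side would have smaller norm.\<close>
  define R where "R = Max (range (\<lambda>(i, j). fabs (?y $ i $ j)))"
  have fin: "finite (range (\<lambda>(i, j). fabs (?y $ i $ j)))" by simp
  have le: "fabs (?y $ i $ j) \<le> R" for i j
    unfolding R_def by (rule Max_ge[OF fin]) (auto intro: range_eqI[of _ _ "(i, j)"])
  then have yR: "?y \<in> mball R" and R0: "0 \<le> R"
    unfolding mball_def using fabs_ge_zero order_trans by blast+
  have y: "?y = mat 1 - (x - mat 1) ** ?y"
    by (simp add: matrix_diff_rdistrib xy)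
  have "mat 1 - (x - mat 1) ** ?y \<in> mball (max 1 (r * R))"
    using mball_mult[OF assms(1) yR assms(3) R0]
    by (intro mball_diff) (auto intro: mball_mono[OF mball_mat_1] mball_mono)
  then have "?y \<in> mball (max 1 (r * R))" using y by simp
  moreover have "R \<in> range (\<lambda>(i, j). fabs (?y $ i $ j))"
    unfolding R_def by (rule Max_in[OF fin]) auto
  ultimately have "R \<le> max 1 (r * R)" by (auto simp: mball_def)
  then have "R \<le> 1" using assms R0 mult_right_mono[of r 1 R]
    by (smt (verit) mult_less_cancel_right2)
  then show "?y \<in> mball 1" using yR mball_mono by blast
qed

text \<open>
  The metric on matrices combines the entrywise distances by a Euclidean norm. Smoothness refers to
  this metric and the estimates refer to the maximum norm; both have the same neighbourhoods.
\<close>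

lemma mball_of_dist:
  fixes x y :: "'a::nonarch_valued_field ^ 'n ^ 'm"
  assumes "dist x y \<le> r"
  shows "x - y \<in> mball r"
proof -
  have "dist (x $ i $ j) (y $ i $ j) \<le> dist x y" for i j
    using dist_vec_nth_le[of "x $ i" j "y $ i"] dist_vec_nth_le[of x i y] by linarith
  then show ?thesis using assms unfolding mball_def by (auto simp flip: dist_eq_fabs intro: order_trans)
qed

lemma dist_of_mball:
  fixes x y :: "'a::nonarch_valued_field ^ 'n ^ 'm"
  assumes "x - y \<in> mball r"
  shows "dist x y \<le> real CARD('m) * (real CARD('n) * r)"
proof -
  have "dist (x $ i) (y $ i) \<le> real CARD('n) * r" for i
  proof -
    have "dist (x $ i) (y $ i) \<le> (\<Sum>j\<in>UNIV. dist (x $ i $ j) (y $ i $ j))"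
      unfolding dist_vec_def by (rule L2_set_le_sum) auto
    also have "\<dots> \<le> (\<Sum>j\<in>(UNIV::'n set). r)"
      using assms by (intro sum_mono) (simp add: mball_def dist_eq_fabs)
    finally show ?thesis by simp
  qed
  then have "(\<Sum>i\<in>UNIV. dist (x $ i) (y $ i)) \<le> (\<Sum>i\<in>(UNIV::'m set). real CARD('n) * r)"
    by (intro sum_mono)
  moreover have "dist x y \<le> (\<Sum>i\<in>UNIV. dist (x $ i) (y $ i))"
    unfolding dist_vec_def by (rule L2_set_le_sum) auto
  ultimately show ?thesis by simp
qed

lemma ex_mball_of_dist:
  fixes x :: "'a::nonarch_valued_field ^ 'n ^ 'm"
  assumes "0 < e"
  shows "\<exists>r>0. \<forall>y. y - x \<in> mball r \<longrightarrow> dist y x < e"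
proof -
  let ?N = "real CARD('m) * real CARD('n)"
  have "0 < ?N" by simp
  have "dist y x < e" if "y - x \<in> mball (e / (2 * ?N))" for y
    using dist_of_mball[OF that] assms by simp
  with \<open>0 < ?N\<close> assms show ?thesis by (intro exI[of _ "e / (2 * ?N)"]) auto
qed

section \<open>Finite covers and transversals\<close>

text \<open>
  Expansion in powers of a uniformizer: \<open>k\<close> digits, each from a finite set of representatives of the
  residue field, determine an integral element up to \<open>fabs p ^ k\<close>.
\<close>

lemma finite_cover_unit_ball:
  assumes "nonarch_local_field TYPE('a::nonarch_valued_field)"
  shows "\<exists>p::'a. p \<noteq> 0 \<and> fabs p < 1 \<and>
    (\<forall>k. \<exists>F::'a set. finite F \<and> (\<forall>x. fabs x \<le> 1 \<longrightarrow> (\<exists>y\<in>F. fabs (x - y) \<le> fabs p ^ k)))"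
proof -
  from assms obtain p :: 'a where p: "uniformizer p"
    and fin: "finite (residue_field :: 'a set set)"
    by (auto simp: nonarch_local_field_def)
  from p have p0: "p \<noteq> 0" and p1: "fabs p < 1" and max: "fabs x < 1 \<Longrightarrow> fabs x \<le> fabs p" for x :: 'a
    by (auto simp: uniformizer_def)
  have "\<exists>F0\<subseteq>cball 0 1. finite F0 \<and> (\<lambda>x::'a. ball x 1) ` cball 0 1 = (\<lambda>x. ball x 1) ` F0"
    using fin unfolding residue_field_def by (intro finite_subset_image) auto
  then obtain F0 :: "'a set" where F0: "finite F0"
      "(\<lambda>x. ball x 1) ` cball 0 1 = (\<lambda>x. ball x 1) ` F0" by blast
  have p_pos: "0 < fabs p" using p0 by (simp add: less_le)
  have cover0: "\<exists>y\<in>F0. fabs (x - y) \<le> fabs p" if "fabs x \<le> 1" for x :: 'a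
  proof -
    have "x \<in> cball 0 1" using that by (simp add: dist_eq_fabs)
    then have "ball x 1 \<in> (\<lambda>x. ball x 1) ` F0" unfolding F0(2)[symmetric] by (rule imageI)
    then obtain y where y: "y \<in> F0" "ball x 1 = ball y 1" by auto
    then have "x \<in> ball y 1" by (metis centre_in_ball zero_less_one)
    then show ?thesis using y(1) max by (auto simp: dist_commute dist_eq_fabs)
  qed
  have "\<exists>F::'a set. finite F \<and> (\<forall>x. fabs x \<le> 1 \<longrightarrow> (\<exists>y\<in>F. fabs (x - y) \<le> fabs p ^ k))" for k
  proof (induction k)
    case 0
    show ?case by (rule exI[of _ "{0}"]) auto
  next
    case (Suc k)
    then obtain F :: "'a set" where F: "finite F" "\<And>x. fabs x \<le> 1 \<Longrightarrow> \<exists>y\<in>F. fabs (x - y) \<le> fabs p ^ k"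
      by blast
    let ?F = "(\<lambda>(y, z). y + p * z) ` (F0 \<times> F)"
    have "\<exists>u\<in>?F. fabs (x - u) \<le> fabs p ^ Suc k" if x: "fabs x \<le> 1" for x :: 'a
    proof -
      obtain y where y: "y \<in> F0" "fabs (x - y) \<le> fabs p" using cover0 x by blast
      then have "fabs ((x - y) / p) \<le> 1" using p_pos by (simp add: fabs_divide)
      then obtain z where z: "z \<in> F" "fabs ((x - y) / p - z) \<le> fabs p ^ k" using F(2) by blast
      have "x - (y + p * z) = p * ((x - y) / p - z)" using p0 by (simp add: field_simps)
      then have "fabs (x - (y + p * z)) \<le> fabs p ^ Suc k"
        using z(2) by (simp add: fabs_mult mult_left_mono)
      then show ?thesis using y z by (intro bexI[of _ "y + p * z"]) force+
    qed
    then show ?case using F(1) F0(1) by (intro exI[of _ ?F]) blast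
  qed
  with p0 p1 show ?thesis by blast
qed

text \<open>
  This is how local compactness enters: it makes the index of one ball in a larger one finite, so
  that integrals of locally constant functions become finite sums. A power of the uniformizer moves
  the ball into the valuation ring.
\<close>

lemma finite_cover_ball:
  assumes "finite (UNIV :: 'a set) \<or> nonarch_local_field TYPE('a::nonarch_valued_field)"
    and "0 < e"
  shows "\<exists>F::'a set. finite F \<and> (\<forall>x::'a. fabs x \<le> R \<longrightarrow> (\<exists>y\<in>F. fabs (x - y) \<le> e))"
  using assms(1)
proof
  assume "finite (UNIV :: 'a set)"
  moreover have "fabs (x - x) \<le> e" for x :: 'a using \<open>0 < e\<close> by simp
  ultimately show ?thesis by blast
next
  assume "nonarch_local_field TYPE('a)"
  then obtain p :: 'a where p: "p \<noteq> 0" "fabs p < 1"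
    and cover: "\<And>k. \<exists>F::'a set. finite F \<and> (\<forall>x. fabs x \<le> 1 \<longrightarrow> (\<exists>y\<in>F. fabs (x - y) \<le> fabs p ^ k))"
    using finite_cover_unit_ball by blast
  have p_pos: "0 < fabs p" using p by (simp add: less_le)
  obtain m where m: "fabs p ^ m < 1 / (max R 1)" using p real_arch_pow_inv[of "1 / max R 1" "fabs p"] by fastforce
  obtain k where k: "fabs p ^ k < e * fabs p ^ m"
    using p p_pos \<open>0 < e\<close> real_arch_pow_inv[of "e * fabs p ^ m" "fabs p"] by auto
  obtain F :: "'a set" where F: "finite F" "\<And>x. fabs x \<le> 1 \<Longrightarrow> \<exists>y\<in>F. fabs (x - y) \<le> fabs p ^ k"
    using cover[of k] by blast
  have "\<exists>y\<in>(\<lambda>z. z / p ^ m) ` F. fabs (x - y) \<le> e" if x: "fabs x \<le> R" for x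
  proof -
    have "fabs (x * p ^ m) \<le> max R 1 * (1 / max R 1)"
      unfolding fabs_mult fabs_power using x m by (intro mult_mono) auto
    moreover have "max R 1 * (1 / max R 1) = 1" by (simp add: max_def)
    ultimately have "fabs (x * p ^ m) \<le> 1" by linarith
    then obtain z where z: "z \<in> F" "fabs (x * p ^ m - z) \<le> fabs p ^ k" using F by blast
    have "x - z / p ^ m = (x * p ^ m - z) / p ^ m" using p by (simp add: field_simps)
    then have "fabs (x - z / p ^ m) = fabs (x * p ^ m - z) / fabs p ^ m"
      by (simp add: fabs_divide fabs_power)
    also have "\<dots> \<le> e" using z k p_pos by (simp add: divide_le_eq)
    finally show ?thesis using z by blast
  qed
  then show ?thesis using F(1) by (intro exI[of _ "(\<lambda>z. z / p ^ m) ` F"]) blast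
qed

lemma finite_cover_mball:
  assumes "finite (UNIV :: 'a set) \<or> nonarch_local_field TYPE('a::nonarch_valued_field)"
    and "0 < e"
  shows "\<exists>F. finite F \<and> (\<forall>x \<in> mball R :: ('a ^ 'n ^ 'm) set. \<exists>y\<in>F. x - y \<in> mball e)"
proof -
  obtain F :: "'a set" where F: "finite F" "\<And>x. fabs x \<le> R \<Longrightarrow> \<exists>y\<in>F. fabs (x - y) \<le> e"
    using finite_cover_ball[OF assms] by blast
  have fin: "finite {v :: 'b ^ 'k::finite. \<forall>i. v $ i \<in> B}" if "finite B" for B :: "'b set"
  proof -
    have "{v :: 'b ^ 'k. \<forall>i. v $ i \<in> B} \<subseteq> vec_lambda ` (UNIV \<rightarrow>\<^sub>E B)"
      by (rule subsetI) (auto simp: image_iff intro!: bexI[of _ "vec_nth v" for v])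
    then show ?thesis using finite_PiE[of "UNIV :: 'k set" "\<lambda>_. B"] that
      by (meson finite_imageI finite_subset finite_class.finite_UNIV)
  qed
  let ?F = "{v :: 'a ^ 'n ^ 'm. \<forall>i. v $ i \<in> {v. \<forall>j. v $ j \<in> F}}"
  have "finite ?F" by (intro fin F)
  moreover have "\<exists>y\<in>?F. x - y \<in> mball e" if "x \<in> mball R" for x
  proof -
    have "\<forall>i j. \<exists>y. y \<in> F \<and> fabs (x $ i $ j - y) \<le> e" using that F(2) unfolding mball_def by blast
    then obtain y where "\<And>i j. y i j \<in> F \<and> fabs (x $ i $ j - y i j) \<le> e" by metis
    then show ?thesis by (intro bexI[of _ "\<chi> i j. y i j"]) (auto simp: mball_def)
  qed
  ultimately show ?thesis by blast
qed

definition additive_subgroup :: "'b::ab_group_add set \<Rightarrow> bool" where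
  "additive_subgroup L \<longleftrightarrow> 0 \<in> L \<and> (\<forall>x\<in>L. \<forall>y\<in>L. x - y \<in> L)"

lemma additive_subgroupD:
  assumes "additive_subgroup L"
  shows "0 \<in> L" "x \<in> L \<Longrightarrow> y \<in> L \<Longrightarrow> x - y \<in> L" "x \<in> L \<Longrightarrow> - x \<in> L"
    "x \<in> L \<Longrightarrow> y \<in> L \<Longrightarrow> x + y \<in> L"
proof -
  show 0: "0 \<in> L" and d: "\<And>x y. x \<in> L \<Longrightarrow> y \<in> L \<Longrightarrow> x - y \<in> L"
    using assms by (auto simp: additive_subgroup_def)
  show m: "- x \<in> L" if "x \<in> L" for x using d[OF 0 that] that by simp
  show "x + y \<in> L" if "x \<in> L" "y \<in> L" using d[OF that(1) m[OF that(2)]] by simp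
qed

lemma additive_subgroup_mball: "0 \<le> r \<Longrightarrow> additive_subgroup (mball r)"
  by (simp add: additive_subgroup_def mball_diff)

text \<open>
  A finite set of representatives for the cosets of \<open>L'\<close> in \<open>L\<close>. Its cardinality is the index, which
  stands for the ratio of the Haar measures of \<open>L\<close> and \<open>L'\<close>.
\<close>

definition transversal :: "'b::ab_group_add set \<Rightarrow> 'b set \<Rightarrow> 'b set \<Rightarrow> bool" where
  "transversal S L L' \<longleftrightarrow> finite S \<and> S \<subseteq> L \<and> (\<forall>x\<in>L. \<exists>!s. s \<in> S \<and> x - s \<in> L')"

lemma ex_transversal:
  assumes L': "additive_subgroup L'" and "finite F" and F: "\<And>x. x \<in> L \<Longrightarrow> \<exists>y\<in>F. x - y \<in> L'"
  shows "\<exists>S. transversal S L L'"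
proof -
  note L'D = additive_subgroupD[OF L']
  have trans: "x - z \<in> L'" if "x - y \<in> L'" "y - z \<in> L'" for x y z
    using L'D(4)[OF that] by simp
  have sym: "y - x \<in> L'" if "x - y \<in> L'" for x y using L'D(3)[OF that] by simp
  define rep where "rep x = (SOME y. y \<in> L \<and> x - y \<in> L')" for x
  have rep: "rep x \<in> L \<and> x - rep x \<in> L'" if "x \<in> L" for x
    unfolding rep_def by (rule someI[of _ x]) (use that L'D in auto)
  have cong: "rep x = rep y" if "x - y \<in> L'" for x y
    unfolding rep_def using trans sym that by (metis (no_types, lifting))
  have "rep ` L \<subseteq> rep ` F" using F cong by blast
  then have "finite (rep ` L)" using \<open>finite F\<close> finite_surj by blast
  moreover have "\<exists>!s. s \<in> rep ` L \<and> x - s \<in> L'" if "x \<in> L" for x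
  proof (rule ex1I[of _ "rep x"])
    show "rep x \<in> rep ` L \<and> x - rep x \<in> L'" using rep that by blast
    show "s = rep x" if "s \<in> rep ` L \<and> x - s \<in> L'" for s
      using that cong rep by (metis imageE)
  qed
  ultimately have "transversal (rep ` L) L L'" using rep by (auto simp: transversal_def)
  then show ?thesis by blast
qed

lemma transversal_image:
  assumes "transversal S L L'" "bij h" "\<And>x y. h (x - y) = h x - h y"
  shows "transversal (h ` S) (h ` L) (h ` L')"
proof -
  have "\<exists>!s. s \<in> h ` S \<and> h x - s \<in> h ` L'" if x: "x \<in> L" for x
  proof -
    have ex1: "\<exists>!s. s \<in> S \<and> x - s \<in> L'" using assms(1) x by (simp add: transversal_def)
    obtain s where s: "s \<in> S" "x - s \<in> L'" "\<And>s'. s' \<in> S \<Longrightarrow> x - s' \<in> L' \<Longrightarrow> s' = s"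
      using ex1 by blast
    have eq: "h x - h u \<in> h ` L' \<longleftrightarrow> x - u \<in> L'" for u
      by (metis assms(2,3) bij_is_inj inj_image_mem_iff)
    show ?thesis
    proof (rule ex1I[of _ "h s"])
      show "h s \<in> h ` S \<and> h x - h s \<in> h ` L'" using s(1,2) by (simp add: eq)
      fix t assume t: "t \<in> h ` S \<and> h x - t \<in> h ` L'"
      then obtain u where u: "u \<in> S" "t = h u" by blast
      then have "u = s" using t by (intro s(3)) (simp_all add: eq)
      then show "t = h s" using u by simp
    qed
  qed
  then show ?thesis using assms(1) by (simp add: transversal_def image_mono)
qed

text \<open>
  Translation by \<open>x\<close> permutes the cosets of \<open>L'\<close> in \<open>L\<close>, and a periodic function depends on the coset
  only. This takes the place of the invariance of Haar measure.
\<close>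

lemma transversal_sum_shift:
  fixes \<Phi> :: "'b::ab_group_add \<Rightarrow> 'c::comm_monoid_add"
  assumes S: "transversal S L L'" and L: "additive_subgroup L" and L': "additive_subgroup L'"
    and per: "\<And>u y. y \<in> L' \<Longrightarrow> \<Phi> (u + y) = \<Phi> u" and x: "x \<in> L"
  shows "(\<Sum>s\<in>S. \<Phi> (s + x)) = (\<Sum>s\<in>S. \<Phi> s)"
proof -
  note D = additive_subgroupD[OF L] and D' = additive_subgroupD[OF L']
  define rep where "rep u = (THE s. s \<in> S \<and> u - s \<in> L')" for u
  have ex1: "\<exists>!s. s \<in> S \<and> u - s \<in> L'" if "u \<in> L" for u
    using S that by (auto simp: transversal_def)
  have rep: "rep u \<in> S" "u - rep u \<in> L'" if "u \<in> L" for u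
    using theI'[OF ex1[OF that]] by (auto simp: rep_def)
  have rep_eq: "rep u = s" if "u \<in> L" "s \<in> S" "u - s \<in> L'" for u s
    using rep[OF that(1)] ex1[OF that(1)] that by blast
  have SL: "s \<in> L" if "s \<in> S" for s using S that by (auto simp: transversal_def)
  have rep_back: "rep (rep (s + y) - y) = s" if s: "s \<in> S" and y: "y \<in> L" for s y
  proof (rule rep_eq)
    have "s + y \<in> L" using SL s y D by blast
    then show "rep (s + y) - y \<in> L" using rep SL D y by blast
    have "rep (s + y) - y - s = - (s + y - rep (s + y))" by simp
    then show "rep (s + y) - y - s \<in> L'" using rep \<open>s + y \<in> L\<close> D' by presburger
  qed (fact s)
  show ?thesis
  proof (rule sum.reindex_bij_witness[where i = "\<lambda>s. rep (s - x)" and j = "\<lambda>s. rep (s + x)"])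
    fix s assume s: "s \<in> S"
    then have sx: "s + x \<in> L" and sx': "s - x \<in> L" using SL x D by blast+
    show "rep (rep (s + x) - x) = s" by (rule rep_back) (use s x in auto)
    show "rep (s + x) \<in> S" "rep (s - x) \<in> S" using rep sx sx' by auto
    show "rep (rep (s - x) + x) = s" using rep_back[of s "- x"] s x D by simp
    show "\<Phi> (rep (s + x)) = \<Phi> (s + x)"
      using per[of "s + x - rep (s + x)" "rep (s + x)"] rep(2)[OF sx] by simp
  qed
qed

text \<open>Repeated squaring would carry a point other than one out of the disc.\<close>

lemma unit_circle_no_small_subgroups:
  fixes z :: complex
  assumes "\<And>k. cmod (z ^ k - 1) \<le> 1/2"
  shows "z = 1"
proof (rule ccontr)
  assume "z \<noteq> 1"
  \<comment> \<open>Squaring moves a point of the disc away from one by a factor of at least \<open>3/2\<close>.\<close>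
  have "(3/2) ^ k * cmod (z - 1) \<le> cmod (z ^ (2 ^ k) - 1)" for k
  proof (induction k)
    case (Suc k)
    let ?w = "z ^ (2 ^ k)"
    have "2 - cmod (?w - 1) \<le> cmod (?w + 1)"
      using norm_triangle_ineq4[of "?w + 1" "?w - 1"] by (simp add: algebra_simps)
    then have "3/2 \<le> cmod (?w + 1)" using assms[of "2 ^ k"] by linarith
    then have "(3/2) * ((3/2) ^ k * cmod (z - 1)) \<le> cmod (?w + 1) * cmod (?w - 1)"
      using Suc by (intro mult_mono) auto
    also have "\<dots> = cmod (z ^ (2 ^ Suc k) - 1)"
      by (simp add: norm_mult[symmetric] algebra_simps power_mult power2_eq_square)
    finally show ?case by simp
  qed simp
  moreover obtain k where "1 / cmod (z - 1) < (3/2) ^ k"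
    using real_arch_pow[of "3/2" "1 / cmod (z - 1)"] by auto
  then have "1 < (3/2) ^ k * cmod (z - 1)" using \<open>z \<noteq> 1\<close> by (simp add: field_simps)
  ultimately show False using assms[of "2 ^ k"] by (smt (verit) field_sum_of_halves)
qed

text \<open>
  A small ball is a subgroup that continuity maps into a small disc around one, and the unit circle has
  no nontrivial subgroup there.
\<close>

lemma additive_character_trivial_on_ball:
  fixes \<psi> :: "'a::nonarch_valued_field \<Rightarrow> complex"
  assumes "nontrivial_additive_character \<psi>"
  shows "\<exists>r>0. \<forall>x. fabs x \<le> r \<longrightarrow> \<psi> x = 1"
proof -
  have add: "\<psi> (x + y) = \<psi> x * \<psi> y" and "cmod (\<psi> x) = 1" for x y
    using assms by (auto simp: nontrivial_additive_character_def)
  then have "\<psi> 0 = 1"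
    by (metis add_0 mult_cancel_right2 norm_zero zero_neq_one)
  have "isCont \<psi> 0"
    using assms by (simp add: nontrivial_additive_character_def continuous_on_eq_continuous_at)
  then obtain d where d: "d > 0" "\<And>x. dist x 0 < d \<Longrightarrow> dist (\<psi> x) (\<psi> 0) < 1/2"
    unfolding continuous_at_eps_delta by (metis half_gt_zero zero_less_one)
  have "\<psi> x = 1" if x: "fabs x \<le> d / 2" for x
  proof (rule unit_circle_no_small_subgroups)
    fix k
    have "\<exists>y. fabs y \<le> d / 2 \<and> \<psi> y = \<psi> x ^ k"
    proof (induction k)
      case 0
      show ?case using d \<open>\<psi> 0 = 1\<close> by (intro exI[of _ 0]) auto
    next
      case (Suc k)
      then obtain y where "fabs y \<le> d / 2" "\<psi> y = \<psi> x ^ k" by blast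
      then show ?case using x by (intro exI[of _ "x + y"]) (simp only: add fabs_add_bound power_Suc simp_thms)
    qed
    then obtain y where "fabs y \<le> d / 2" "\<psi> y = \<psi> x ^ k" by blast
    then show "cmod (\<psi> x ^ k - 1) \<le> 1/2"
      using d(1) d(2)[of y] \<open>\<psi> 0 = 1\<close> by (simp add: dist_eq_fabs dist_norm)
  qed
  then show ?thesis using d(1) by (intro exI[of _ "d / 2"]) auto
qed

section \<open>Generation of the general linear group\<close>

text \<open>
  Left multiplication by this matrix adds \<open>v i\<close> times row \<open>m\<close> to row \<open>i\<close>, for all \<open>i\<close> at once; with
  \<open>v m = 0\<close> it is unipotent and can clear a whole column.
\<close>

definition elim_matrix :: "'n \<Rightarrow> ('n \<Rightarrow> 'a) \<Rightarrow> 'a::field ^ 'n ^ 'n" where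
  "elim_matrix m v = (\<chi> i j. of_bool (i = j) + (if j = m then v i else 0))"

lemma elim_matrix_mult: "elim_matrix m v ** A = (\<chi> i j. A $ i $ j + v i * A $ m $ j)"
  by (simp add: vec_eq_iff elim_matrix_def matrix_matrix_mult_def distrib_right sum.distrib
      of_bool_def if_distrib[of "\<lambda>x. x * _"] cong: if_cong)

lemma elim_matrix_add:
  assumes "w m = 0"
  shows "elim_matrix m v ** elim_matrix m w = elim_matrix m (\<lambda>i. v i + w i)"
  unfolding elim_matrix_mult using assms by (auto simp: vec_eq_iff elim_matrix_def)

lemma elim_matrix_zero [simp]: "elim_matrix m (\<lambda>_. 0) = mat 1"
  by (simp add: elim_matrix_def mat_def vec_eq_iff)

lemma elim_matrix_inverse:
  assumes "v m = 0"
  shows "elim_matrix m (\<lambda>i. - v i) ** elim_matrix m v = mat 1"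
    and "elim_matrix m v ** elim_matrix m (\<lambda>i. - v i) = mat 1"
  using assms by (simp_all add: elim_matrix_add)

lemma elim_matrix_GL: "v m = 0 \<Longrightarrow> elim_matrix m v \<in> GL"
  by (blast intro: GL_of_right_inverse elim_matrix_inverse)

text \<open>
  Gaussian elimination. The columns are cleared one after another; a column whose diagonal entry
  vanishes gets a pivot by adding a row, and an eligible row exists because otherwise the column
  would depend linearly on the cleared ones.
\<close>

lemma GL_induct [consumes 1, case_names mult diagonal elim]:
  fixes A :: "'a::field ^ 'n ^ 'n"
  assumes "A \<in> GL"
    and mult: "\<And>A B. A \<in> GL \<Longrightarrow> B \<in> GL \<Longrightarrow> P A \<Longrightarrow> P B \<Longrightarrow> P (A ** B)"
    and diagonal: "\<And>A. A \<in> GL \<Longrightarrow> (\<And>i j. i \<noteq> j \<Longrightarrow> A $ i $ j = 0) \<Longrightarrow> P A"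
    and elim: "\<And>m v. v m = 0 \<Longrightarrow> P (elim_matrix m v)"
  shows "P A"
proof -
  have undo: "P A" if "v m = 0" "A \<in> GL" "P (elim_matrix m v ** A)" for m v A
  proof -
    have "elim_matrix m (\<lambda>i. - v i) ** (elim_matrix m v ** A) = A"
      using that by (simp add: matrix_mul_assoc elim_matrix_inverse)
    moreover have "P (elim_matrix m (\<lambda>i. - v i) ** (elim_matrix m v ** A))"
      using mult[OF elim_matrix_GL[of "\<lambda>i. - v i" m] GL_mult[OF elim_matrix_GL[of v m] that(2)]
          elim[of "\<lambda>i. - v i" m] that(3)] that(1) by simp
    ultimately show ?thesis by simp
  qed
  have cleared: "P A" if "A \<in> GL" "\<forall>i\<in>S. \<forall>j. j \<noteq> i \<longrightarrow> A $ j $ i = 0" for S A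
    using that
  proof (induction "card (- S)" arbitrary: S A rule: less_induct)
    case less
    show ?case
    proof (cases "S = UNIV")
      case True
      then show ?thesis using less.prems by (intro diagonal) auto
    next
      case False
      then obtain m where m: "m \<notin> S" by blast
      have inj: "x = 0" if "A *v x = 0" for x
        using less.prems(1) that unfolding GL_def mem_Collect_eq invertible_left_inverse
          matrix_left_invertible_ker by blast
      have diag: "A $ i $ i \<noteq> 0" if "i \<in> S" for i
      proof
        assume "A $ i $ i = 0"
        then have "A $ j $ i = 0" for j using less.prems(2) that by (cases "j = i") auto
        then have "A *v axis i 1 = 0"
          by (simp add: vec_eq_iff matrix_vector_mult_def axis_def if_distrib cong: if_cong)
        then show False using inj by fastforce
      qed
      have "\<exists>j. j \<notin> S \<and> A $ j $ m \<noteq> 0"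
      proof (rule ccontr)
        assume none: "\<not> ?thesis"
        let ?x = "\<chi> i. if i = m then 1 else if i \<in> S then - (A $ i $ m / A $ i $ i) else 0"
        have "(A *v ?x) $ j = 0" for j
        proof -
          have "A $ j $ i * ?x $ i = (if i = m then A $ j $ m else 0)
              + (if i = j then (if j \<in> S then - A $ j $ m else 0) else 0)" for i
            using less.prems(2) m none diag by auto
          then have "(A *v ?x) $ j = (\<Sum>i\<in>UNIV. (if i = m then A $ j $ m else 0)
              + (if i = j then (if j \<in> S then - A $ j $ m else 0) else 0))"
            unfolding matrix_vector_mult_def by simp
          also have "\<dots> = 0" using none by (auto simp: sum.distrib)
          finally show ?thesis .
        qed
        then have "A *v ?x = 0" unfolding vec_eq_iff zero_index by blast
        from arg_cong[OF inj[OF this], of "\<lambda>x. x $ m"] show False by simp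
      qed
      then obtain j where j: "j \<notin> S" "A $ j $ m \<noteq> 0" by blast
      define u where "u = (\<lambda>i. of_bool (i = m \<and> A $ m $ m = 0) :: 'a)"
      define B where "B = elim_matrix j u ** A"
      have u: "u j = 0" using j by (auto simp: u_def)
      have B: "B $ i $ k = A $ i $ k + u i * A $ j $ k" for i k
        by (simp add: B_def elim_matrix_mult)
      have B_clear: "B $ k $ i = 0" if "i \<in> S" "k \<noteq> i" for i k
        using that less.prems(2) j(1) by (auto simp: B)
      have B_pivot: "B $ m $ m \<noteq> 0" using j by (auto simp: B u_def)
      define v where "v = (\<lambda>i. if i = m then 0 else - (B $ i $ m / B $ m $ m))"
      have v: "v m = 0" by (simp add: v_def)
      have BGL: "B \<in> GL" unfolding B_def by (intro GL_mult elim_matrix_GL u less.prems)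
      have "P (elim_matrix m v ** B)"
      proof (rule less.hyps[of "insert m S"])
        have "- insert m S \<subset> - S" using m by blast
        then show "card (- insert m S) < card (- S)" by (intro psubset_card_mono) auto
        show "elim_matrix m v ** B \<in> GL" by (intro GL_mult elim_matrix_GL v BGL)
        show "\<forall>i\<in>insert m S. \<forall>k. k \<noteq> i \<longrightarrow> (elim_matrix m v ** B) $ k $ i = 0"
        proof (intro ballI allI impI)
          fix i k assume i: "i \<in> insert m S" and k: "k \<noteq> i"
          show "(elim_matrix m v ** B) $ k $ i = 0"
          proof (cases "i = m")
            case True
            then show ?thesis using k B_pivot by (simp add: elim_matrix_mult v_def)
          next
            case False
            then have "B $ k $ i = 0" "B $ m $ i = 0" using i k B_clear[of i] by auto
            then show ?thesis by (simp add: elim_matrix_mult)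
          qed
        qed
      qed
      then have "P B" using undo v BGL by blast
      then show ?thesis using undo u less.prems(1) unfolding B_def by blast
    qed
  qed
  show ?thesis using cleared[of A "{}"] assms(1) by simp
qed

section \<open>Block matrices\<close>

definition upper_left :: "'a ^ ('n + 'n) ^ ('n + 'n) \<Rightarrow> 'a ^ 'n ^ 'n" where
  "upper_left g = (\<chi> i j. g $ Inl i $ Inl j)"

definition upper_right :: "'a ^ ('n + 'n) ^ ('n + 'n) \<Rightarrow> 'a ^ 'n ^ 'n" where
  "upper_right g = (\<chi> i j. g $ Inl i $ Inr j)"

definition lower_left :: "'a ^ ('n + 'n) ^ ('n + 'n) \<Rightarrow> 'a ^ 'n ^ 'n" where
  "lower_left g = (\<chi> i j. g $ Inr i $ Inl j)"

definition lower_right :: "'a ^ ('n + 'n) ^ ('n + 'n) \<Rightarrow> 'a ^ 'n ^ 'n" where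
  "lower_right g = (\<chi> i j. g $ Inr i $ Inr j)"

lemma blocks_of_block [simp]:
  "upper_left (block a b c d) = a" "upper_right (block a b c d) = b"
  "lower_left (block a b c d) = c" "lower_right (block a b c d) = d"
  by (simp_all add: upper_left_def upper_right_def lower_left_def lower_right_def block_def)

lemma block_of_blocks:
  "block (upper_left g) (upper_right g) (lower_left g) (lower_right g) = g"
  by (simp add: vec_eq_iff upper_left_def upper_right_def lower_left_def lower_right_def block_def
      split: sum.split)

lemma block_cases: obtains a b c d where "g = block a b c d"
  using block_of_blocks by metis

lemma block_eq_iff: "block a b c d = block a' b' c' d' \<longleftrightarrow> a = a' \<and> b = b' \<and> c = c' \<and> d = d'"
  by (metis blocks_of_block)

lemma sum_UNIV_sum: "(\<Sum>k\<in>UNIV. f k) = (\<Sum>i\<in>UNIV. f (Inl i)) + (\<Sum>j\<in>UNIV. f (Inr j))"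
  for f :: "'n::finite + 'm::finite \<Rightarrow> 'a::comm_monoid_add"
  unfolding UNIV_Plus_UNIV[symmetric] by (subst sum.Plus) auto

lemma block_mult:
  "block a b c d ** block a' b' c' d' =
    block (a ** a' + b ** c') (a ** b' + b ** d') (c ** a' + d ** c') (c ** b' + d ** d')"
  by (simp add: vec_eq_iff block_def matrix_matrix_mult_def sum_UNIV_sum split: sum.split)

lemma block_one: "block (mat 1) 0 0 (mat 1) = mat 1"
  by (simp add: vec_eq_iff block_def mat_def split: sum.split)

lemma block_diff: "block a b c d - block a' b' c' d' = block (a - a') (b - b') (c - c') (d - d')"
  by (simp add: vec_eq_iff block_def split: sum.split)

lemma block_mball_iff:
  "block a b c d \<in> mball r \<longleftrightarrow> a \<in> mball r \<and> b \<in> mball r \<and> c \<in> mball r \<and> d \<in> mball r"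
proof -
  have all_sum: "(\<forall>k. Q k) \<longleftrightarrow> (\<forall>i. Q (Inl i)) \<and> (\<forall>i. Q (Inr i))" for Q :: "'x + 'y \<Rightarrow> bool"
    by (metis old.sum.exhaust)
  show ?thesis by (auto simp: mball_def all_sum block_def)
qed

abbreviation unip :: "'a::field ^ 'n ^ 'n \<Rightarrow> 'a ^ ('n + 'n) ^ ('n + 'n)" where
  "unip x \<equiv> block (mat 1) x 0 (mat 1)"

abbreviation diag_block :: "'a::field ^ 'n ^ 'n \<Rightarrow> 'a ^ ('n + 'n) ^ ('n + 'n)" where
  "diag_block g \<equiv> block g 0 0 g"

lemma block_upper_GL:
  assumes "a \<in> GL" "d \<in> GL"
  shows "block a x 0 d \<in> GL"
proof (rule GL_of_right_inverse)
  show "block a x 0 d ** block (matrix_inv a) (- (matrix_inv a ** x ** matrix_inv d)) 0 (matrix_inv d)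
      = mat 1"
  proof -
    have "a ** - (matrix_inv a ** x ** matrix_inv d) = - (x ** matrix_inv d)"
      using assms matrix_diff_ldistrib[of a 0 "matrix_inv a ** x ** matrix_inv d"]
      by (simp add: matrix_mul_assoc matrix_inv_right)
    then show ?thesis using assms by (simp add: block_mult matrix_inv_right block_one)
  qed
qed

lemma unip_GL [simp]: "unip x \<in> GL"
  by (simp add: block_upper_GL)

lemma diag_block_mult: "diag_block g ** diag_block h = diag_block (g ** h)"
  by (simp add: block_mult)

lemma diag_block_GL: "g \<in> GL \<Longrightarrow> diag_block g \<in> GL"
  by (simp add: block_upper_GL)

lemma diag_block_unip:
  assumes "g \<in> GL"
  shows "diag_block g ** unip x = unip (g ** x ** matrix_inv g) ** diag_block g"
  using assms by (simp add: block_mult matrix_inv_mult_cancel)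

lemma trace_conj: "g \<in> GL \<Longrightarrow> trace (g ** x ** matrix_inv g) = trace x"
  by (metis trace_mul_sym matrix_mul_assoc matrix_inv_left matrix_mul_lid)

section \<open>Tensor products\<close>

lemma clinearD:
  assumes "clinear f"
  shows "f (x + y) = f x + f y" "f (c *\<^sub>C x) = c *\<^sub>C f x" "f (x - y) = f x - f y" "f 0 = 0"
    "f (\<Sum>i\<in>A. g i) = (\<Sum>i\<in>A. f (g i))"
proof -
  interpret Vector_Spaces.linear scaleC scaleC f by (fact assms)
  show "f (x + y) = f x + f y" "f (c *\<^sub>C x) = c *\<^sub>C f x" "f (x - y) = f x - f y" "f 0 = 0"
    "f (\<Sum>i\<in>A. g i) = (\<Sum>i\<in>A. f (g i))"
    by (simp_all add: add scale diff sum)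
qed

lemma clinearI:
  assumes "\<And>x y. f (x + y) = f x + f y" "\<And>c x. f (c *\<^sub>C x) = c *\<^sub>C f x"
  shows "clinear f"
  using assms by (auto intro!: Vector_Spaces.linear_iff[THEN iffD2] complex_vector.vector_space_axioms)

lemma tensor_induct [case_names zero add pure]:
  fixes t :: "('v::complex_vector, 'w::complex_vector) tensor"
  assumes zero: "P 0" and add: "\<And>s t. P s \<Longrightarrow> P t \<Longrightarrow> P (s + t)"
    and pure: "\<And>v w. P (pure_tensor v w)"
  shows "P t"
proof (induction t)
  case (1 p)
  show ?case
  proof (induction p rule: update_induct)
    case const
    show ?case using zero by (simp flip: zero_tensor.abs_eq)
  next
    case (update p k c)
    obtain v w where k: "k = (v, w)" by (cases k)
    have "Poly_Mapping.update k c p = p + c *\<^sub>C Poly_Mapping.single k 1"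
      using update(1) by (intro poly_mapping_eqI)
        (auto simp: lookup_update lookup_add scaleC_poly_mapping.rep_eq lookup_single
          scaleC_complex_def when_def in_keys_iff)
    then have "abs_tensor (Poly_Mapping.update k c p) = abs_tensor p + c *\<^sub>C pure_tensor v w"
      by (simp add: k pure_tensor.abs_eq plus_tensor.abs_eq scaleC_tensor.abs_eq)
    then show ?case using add[OF update(3) pure[of "c *\<^sub>C v" w]]
      by (simp add: pure_tensor_scaleC_left)
  qed
qed

lemma tensor_map_comp:
  assumes "clinear f" "clinear g" "clinear f'" "clinear g'"
  shows "tensor_map f g (tensor_map f' g' t) = tensor_map (\<lambda>v. f (f' v)) (\<lambda>w. g (g' w)) t"
proof -
  have c: "clinear (\<lambda>v. f (f' v))" "clinear (\<lambda>w. g (g' w))"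
    using assms by (auto intro!: clinearI simp: clinearD)
  show ?thesis
    by (induction t rule: tensor_induct)
      (simp_all add: clinearD[OF clinear_tensor_map] assms c tensor_map_pure)
qed

lemma ex_functional:
  fixes v :: "'v::complex_vector"
  assumes "v \<noteq> 0"
  shows "\<exists>\<phi> :: 'v \<Rightarrow> complex. clinear \<phi> \<and> \<phi> v = 1"
proof -
  have ind: "complex_vector.independent {v}" using assms by simp
  define B where "B = complex_vector.extend_basis {v}"
  have B: "complex_vector.independent B" "v \<in> B" "complex_vector.span B = UNIV"
    using complex_vector.independent_extend_basis[OF ind] complex_vector.extend_basis_superset[OF ind]
      complex_vector.span_extend_basis[OF ind] by (auto simp: B_def)
  have "clinear (\<lambda>x. complex_vector.representation B x v)"
    using B by (intro clinearI)
      (simp_all add: complex_vector.representation_add complex_vector.representation_scale scaleC_complex_def)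
  then show ?thesis using complex_vector.representation_basis[OF B(1,2)] by auto
qed

text \<open>A pair of functionals extends to the free vector space and kills the bilinearity relations.\<close>

lemma pure_tensor_nonzero:
  fixes v :: "'v::complex_vector" and w :: "'w::complex_vector"
  assumes "v \<noteq> 0" "w \<noteq> 0"
  shows "pure_tensor v w \<noteq> 0"
proof
  assume "pure_tensor v w = 0"
  then have rel: "Poly_Mapping.single (v, w) 1 \<in> complex_vector.span tensor_relations"
    by (transfer fixing: v w) (simp add: tensor_rel_def)
  obtain \<phi> where \<phi>: "clinear \<phi>" "\<phi> v = (1::complex)" using ex_functional[OF assms(1)] by blast
  obtain \<eta> where \<eta>: "clinear \<eta>" "\<eta> w = (1::complex)" using ex_functional[OF assms(2)] by blast
  define E where "E p = (\<Sum>k\<in>Poly_Mapping.keys p. Poly_Mapping.lookup p k * (\<phi> (fst k) * \<eta> (snd k)))"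
    for p
  have superset: "E p = (\<Sum>k\<in>A. Poly_Mapping.lookup p k * (\<phi> (fst k) * \<eta> (snd k)))"
    if "finite A" "Poly_Mapping.keys p \<subseteq> A" for p A
    unfolding E_def by (rule sum.mono_neutral_left) (use that in \<open>auto simp: in_keys_iff\<close>)
  have E_add: "E (p + q) = E p + E q" for p q
  proof -
    let ?A = "Poly_Mapping.keys p \<union> Poly_Mapping.keys q"
    show ?thesis
      by (subst (1 2 3) superset[where A = ?A])
        (auto simp: lookup_add sum.distrib distrib_right dest: subsetD[OF Poly_Mapping.keys_add])
  qed
  have E_scale: "E (c *\<^sub>C p) = c * E p" for c p
    by (subst (1 2) superset[where A = "Poly_Mapping.keys p"])
      (auto simp: in_keys_iff scaleC_poly_mapping.rep_eq scaleC_complex_def sum_distrib_left mult.assoc)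
  have E_diff: "E (p - q) = E p - E q" for p q
    using E_add[of "p - q" q] by simp
  have E_single: "E (Poly_Mapping.single (x, y) 1) = \<phi> x * \<eta> y" for x y
    by (simp add: E_def)
  have "E p = 0" if "p \<in> complex_vector.span tensor_relations" for p
    using that
  proof (induction rule: complex_vector.span_induct_alt)
    case base
    show ?case by (simp add: E_def)
  next
    case (step c x y)
    have "E x = 0" using step(1)
      by (auto simp: tensor_relations_def E_diff E_scale E_single clinearD[OF \<phi>(1)] clinearD[OF \<eta>(1)]
          distrib_left distrib_right mult.left_commute scaleC_complex_def)
    then show ?case using step(2) by (simp add: E_add E_scale)
  qed
  from this[OF rel] show False using \<phi> \<eta> by (simp add: E_single)
qed

section \<open>Smooth vectors of the induced representation\<close>

lemma right_translation_mult:
  "right_translation (h ** k) f = right_translation h (right_translation k f)"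
  by (simp add: right_translation_def matrix_mul_assoc)

lemma right_translation_one: "right_translation (mat 1) f = f"
  by (simp add: right_translation_def)

lemma right_translation_add: "right_translation h (f + f') = right_translation h f + right_translation h f'"
  by (simp add: right_translation_def plus_fun_def)

lemma right_translation_scale: "right_translation h (c *\<^sub>C f) = c *\<^sub>C right_translation h f"
  by (simp add: right_translation_def scaleC_fun_def)

lemma right_translation_diff: "right_translation h (f - f') = right_translation h f - right_translation h f'"
  by (simp add: right_translation_def fun_diff_def)

lemma clinear_right_translation: "clinear (right_translation h :: _ \<Rightarrow> _ \<Rightarrow> 'v::complex_vector)"
  by (rule clinearI) (simp_all add: right_translation_add right_translation_scale)

lemma openin_mball:
  fixes S T :: "('a::nonarch_valued_field ^ 'n ^ 'm) set"
  assumes "openin (top_of_set S) T" "x \<in> T"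
  shows "\<exists>r>0. \<forall>y\<in>S. y - x \<in> mball r \<longrightarrow> y \<in> T"
proof -
  have "\<exists>e>0. \<forall>y\<in>S. dist y x < e \<longrightarrow> y \<in> T"
    using assms by (simp add: openin_euclidean_subtopology_iff)
  then obtain e where e: "e > 0" "\<forall>y\<in>S. dist y x < e \<longrightarrow> y \<in> T" by blast
  with ex_mball_of_dist[OF e(1), of x] show ?thesis by blast
qed

text \<open>
  The stabilizer is a subgroup, so it is open as soon as it contains a neighbourhood of the identity.
\<close>

lemma smooth_iff_near_one:
  fixes f :: "'a::nonarch_valued_field ^ 'm ^ 'm \<Rightarrow> 'v"
  shows "openin (top_of_set GL) {k \<in> GL. right_translation k f = f} \<longleftrightarrow>
    (\<exists>r>0. \<forall>k\<in>GL. k - mat 1 \<in> mball r \<longrightarrow> right_translation k f = f)"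
proof
  assume "openin (top_of_set GL) {k \<in> GL. right_translation k f = f}"
  moreover have "mat 1 \<in> {k \<in> GL. right_translation k f = f}"
    by (simp add: right_translation_one)
  ultimately show "\<exists>r>0. \<forall>k\<in>GL. k - mat 1 \<in> mball r \<longrightarrow> right_translation k f = f"
    using openin_mball by fastforce
next
  assume "\<exists>r>0. \<forall>k\<in>GL. k - mat 1 \<in> mball r \<longrightarrow> right_translation k f = f"
  then obtain r where r: "r > 0"
    "\<And>k. k \<in> GL \<Longrightarrow> k - mat 1 \<in> mball r \<Longrightarrow> right_translation k f = f" by blast
  have "\<exists>e>0. \<forall>k'\<in>GL. dist k' k < e \<longrightarrow> k' \<in> {k \<in> GL. right_translation k f = f}"
    if k: "k \<in> {k \<in> GL. right_translation k f = f}" for k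
  proof -
    obtain s where s: "s \<ge> 1" "matrix_inv k \<in> mball s" using ex_mball by blast
    have "right_translation k' f = f" if k': "k' \<in> GL" "dist k' k < r / s" for k'
    proof -
      have "k' - k \<in> mball (r / s)" using k'(2) by (intro mball_of_dist) simp
      from mball_mult[OF this s(2)] have "(k' - k) ** matrix_inv k \<in> mball r"
        using r(1) s(1) by simp
      then have "k' ** matrix_inv k - mat 1 \<in> mball r"
        using k by (simp add: matrix_diff_rdistrib matrix_inv_right)
      then have "right_translation (k' ** matrix_inv k) f = f"
        using k k' by (intro r GL_mult matrix_inv_GL) auto
      then have "right_translation (k' ** matrix_inv k ** k) f = f"
        using k by (simp only: right_translation_mult[of "k' ** matrix_inv k"] mem_Collect_eq)
      then show ?thesis using k by (simp add: matrix_inv_mult_cancel)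
    qed
    then show ?thesis using r(1) s(1) by (intro exI[of _ "r / s"]) auto
  qed
  then show "openin (top_of_set GL) {k \<in> GL. right_translation k f = f}"
    unfolding openin_euclidean_subtopology_iff by blast
qed

text \<open>The stabilizer of a translate is a conjugate of the stabilizer.\<close>

lemma smooth_right_translation:
  assumes "h \<in> GL" "r > 0" and
    r: "\<And>k. k \<in> GL \<Longrightarrow> k - mat 1 \<in> mball r \<Longrightarrow> right_translation k f = f"
  shows "\<exists>r>0. \<forall>k\<in>GL. k - mat 1 \<in> mball r \<longrightarrow>
    right_translation k (right_translation h f) = right_translation h f"
proof -
  obtain s where s: "s \<ge> 1" "h \<in> mball s" using ex_mball by blast
  obtain s' where s': "s' \<ge> 1" "matrix_inv h \<in> mball s'" using ex_mball by blast
  have "right_translation k (right_translation h f) = right_translation h f"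
    if k: "k \<in> GL" "k - mat 1 \<in> mball (r / (s * s'))" for k
  proof -
    have "matrix_inv h ** (k - mat 1) ** h \<in> mball (s' * (r / (s * s')) * s)"
      using s s' k assms(2) by (intro mball_mult) auto
    moreover have "s' * (r / (s * s')) * s = r" using s(1) s'(1) by simp
    ultimately have "matrix_inv h ** k ** h - mat 1 \<in> mball r"
      using assms(1) by (simp add: matrix_diff_ldistrib matrix_diff_rdistrib matrix_inv_left)
    then have "right_translation (matrix_inv h ** k ** h) f = f"
      using k assms(1) by (intro r GL_mult matrix_inv_GL) auto
    then have "right_translation h (right_translation (matrix_inv h ** k ** h) f) = right_translation h f"
      by simp
    moreover have "h ** (matrix_inv h ** k ** h) = k ** h"
      using assms(1) by (simp add: matrix_mul_assoc matrix_inv_right)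
    ultimately show ?thesis by (metis right_translation_mult)
  qed
  then show ?thesis using assms(2) s(1) s'(1) by (intro exI[of _ "r / (s * s')"]) auto
qed

lemma smooth_repD:
  assumes "smooth_rep \<rho>"
  shows "g \<in> GL \<Longrightarrow> clinear (\<rho> g)" "\<rho> (mat 1) v = v"
    "g \<in> GL \<Longrightarrow> h \<in> GL \<Longrightarrow> \<rho> (g ** h) v = \<rho> g (\<rho> h v)"
  using assms by (auto simp: smooth_rep_def)

lemma smooth_rep_near_one:
  fixes \<rho> :: "'a::nonarch_valued_field ^ 'n ^ 'n \<Rightarrow> 'v::complex_vector \<Rightarrow> 'v"
  assumes "smooth_rep \<rho>"
  shows "\<exists>r>0. \<forall>g\<in>GL. g - mat 1 \<in> mball r \<longrightarrow> \<rho> g v = v"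
proof -
  have "openin (top_of_set GL) {g \<in> GL. \<rho> g v = v}" "mat 1 \<in> {g \<in> GL. \<rho> g v = v}"
    using assms by (auto simp: smooth_rep_def)
  from openin_mball[OF this] show ?thesis by simp
qed

section \<open>Sections supported on the open orbit\<close>

locale induction_data =
  fixes \<rho>1 :: "'a::nonarch_valued_field ^ 'n ^ 'n \<Rightarrow> 'v::complex_vector \<Rightarrow> 'v"
    and \<rho>2 :: "'a ^ 'n ^ 'n \<Rightarrow> 'w::complex_vector \<Rightarrow> 'w"
    and \<psi> :: "'a \<Rightarrow> complex"
  assumes locally_compact: "finite (UNIV :: 'a set) \<or> nonarch_local_field TYPE('a)"
    and \<psi>: "nontrivial_additive_character \<psi>"
    and \<rho>1: "smooth_rep \<rho>1" and \<rho>2: "smooth_rep \<rho>2"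
begin

abbreviation ind :: "('a ^ ('n + 'n) ^ ('n + 'n) \<Rightarrow> ('v, 'w) tensor) set" where
  "ind \<equiv> parabolic_ind \<rho>1 \<rho>2"

abbreviation kernel :: "('a ^ ('n + 'n) ^ ('n + 'n) \<Rightarrow> ('v, 'w) tensor) set" where
  "kernel \<equiv> jacquet_kernel \<psi> right_translation ind"

abbreviation \<sigma> :: "'a ^ 'n ^ 'n \<Rightarrow> 'a ^ 'n ^ 'n \<Rightarrow> ('v, 'w) tensor \<Rightarrow> ('v, 'w) tensor" where
  "\<sigma> a d \<equiv> tensor_map (\<rho>1 a) (\<rho>2 d)"

text \<open>
  This is how left multiplication by an element of the parabolic with diagonal blocks \<open>a\<close>, \<open>d\<close>
  transforms the values of a function in the induced space.
\<close>

definition levi_action ::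
  "'a ^ 'n ^ 'n \<Rightarrow> 'a ^ 'n ^ 'n \<Rightarrow> ('v, 'w) tensor \<Rightarrow> ('v, 'w) tensor" where
  "levi_action a d t = complex_of_real (sqrt (modular_char a d)) *\<^sub>C \<sigma> a d t"

lemma clinear_\<sigma>: "a \<in> GL \<Longrightarrow> d \<in> GL \<Longrightarrow> clinear (\<sigma> a d)"
  by (intro clinear_tensor_map smooth_repD[OF \<rho>1] smooth_repD[OF \<rho>2])

lemma \<sigma>_mult:
  assumes "a \<in> GL" "d \<in> GL" "a' \<in> GL" "d' \<in> GL"
  shows "\<sigma> (a ** a') (d ** d') t = \<sigma> a d (\<sigma> a' d' t)"
proof -
  have "\<rho>1 (a ** a') = (\<lambda>v. \<rho>1 a (\<rho>1 a' v))" "\<rho>2 (d ** d') = (\<lambda>w. \<rho>2 d (\<rho>2 d' w))"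
    using assms smooth_repD(3)[OF \<rho>1] smooth_repD(3)[OF \<rho>2] by auto
  moreover have "clinear (\<rho>1 a)" "clinear (\<rho>1 a')" "clinear (\<rho>2 d)" "clinear (\<rho>2 d')"
    using assms smooth_repD(1)[OF \<rho>1] smooth_repD(1)[OF \<rho>2] by auto
  ultimately show ?thesis by (simp add: tensor_map_comp)
qed

lemma \<sigma>_one: "\<sigma> (mat 1) (mat 1) t = t"
proof (induction t rule: tensor_induct)
  case (pure v w)
  show ?case
    by (subst tensor_map_pure) (simp_all add: smooth_repD[OF \<rho>1] smooth_repD[OF \<rho>2])
qed (simp_all add: clinearD[OF clinear_\<sigma>])

text \<open>A tensor is a finite sum of pure ones, and the stabilizers of finitely many vectors are open.\<close>

lemma \<sigma>_near_one:
  "\<exists>r>0. \<forall>a\<in>GL. \<forall>d\<in>GL. a - mat 1 \<in> mball r \<longrightarrow> d - mat 1 \<in> mball r \<longrightarrow> \<sigma> a d t = t"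
proof (induction t rule: tensor_induct)
  case zero
  show ?case by (intro exI[of _ 1]) (simp add: clinearD[OF clinear_\<sigma>])
next
  case (add s t)
  from add.IH(1) obtain r where r: "r > 0"
    "\<And>a d. a \<in> GL \<Longrightarrow> d \<in> GL \<Longrightarrow> a - mat 1 \<in> mball r \<Longrightarrow> d - mat 1 \<in> mball r \<Longrightarrow> \<sigma> a d s = s"
    by blast
  from add.IH(2) obtain r' where r': "r' > 0"
    "\<And>a d. a \<in> GL \<Longrightarrow> d \<in> GL \<Longrightarrow> a - mat 1 \<in> mball r' \<Longrightarrow> d - mat 1 \<in> mball r' \<Longrightarrow> \<sigma> a d t = t"
    by blast
  have "\<sigma> a d (s + t) = s + t"
    if "a \<in> GL" "d \<in> GL" "a - mat 1 \<in> mball (min r r')" "d - mat 1 \<in> mball (min r r')" for a d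
    using that r(2) r'(2) mball_mono[OF that(3)] mball_mono[OF that(4)]
    by (simp add: clinearD[OF clinear_\<sigma>])
  then show ?case using r(1) r'(1) by (intro exI[of _ "min r r'"]) auto
next
  case (pure v w)
  obtain r where r: "r > 0" "\<And>a. a \<in> GL \<Longrightarrow> a - mat 1 \<in> mball r \<Longrightarrow> \<rho>1 a v = v"
    using smooth_rep_near_one[OF \<rho>1] by metis
  obtain r' where r': "r' > 0" "\<And>d. d \<in> GL \<Longrightarrow> d - mat 1 \<in> mball r' \<Longrightarrow> \<rho>2 d w = w"
    using smooth_rep_near_one[OF \<rho>2] by metis
  have "\<sigma> a d (pure_tensor v w) = pure_tensor v w"
    if "a \<in> GL" "d \<in> GL" "a - mat 1 \<in> mball (min r r')" "d - mat 1 \<in> mball (min r r')" for a d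
    using that r(2) r'(2) mball_mono[OF that(3)] mball_mono[OF that(4)]
      smooth_repD(1)[OF \<rho>1] smooth_repD(1)[OF \<rho>2]
    by (simp add: tensor_map_pure)
  then show ?case using r(1) r'(1) by (intro exI[of _ "min r r'"]) auto
qed

lemma clinear_levi_action: "a \<in> GL \<Longrightarrow> d \<in> GL \<Longrightarrow> clinear (levi_action a d)"
  by (rule clinearI) (simp_all add: levi_action_def clinearD[OF clinear_\<sigma>] scaleC_add_right
      scaleC_scaleC mult.commute)

lemma levi_action_mult:
  assumes "a \<in> GL" "d \<in> GL" "a' \<in> GL" "d' \<in> GL"
  shows "levi_action (a ** a') (d ** d') t = levi_action a d (levi_action a' d' t)"
proof -
  have "modular_char (a ** a') (d ** d') = modular_char a d * modular_char a' d'"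
    by (simp add: modular_char_def det_mul fabs_mult power_mult_distrib power_divide)
  then show ?thesis
    using assms by (simp add: levi_action_def \<sigma>_mult clinearD[OF clinear_\<sigma>] real_sqrt_mult scaleC_scaleC)
qed

lemma levi_action_unimodular:
  "fabs (det a) = fabs (det d) \<Longrightarrow> d \<in> GL \<Longrightarrow> levi_action a d t = \<sigma> a d t"
  using det_GL[of d] by (simp add: levi_action_def modular_char_def scaleC_one)

text \<open>The modular character is trivial on the diagonally embedded group.\<close>

lemma levi_action_diagonal:
  assumes "a \<in> GL" "d \<in> GL" "g \<in> GL"
  shows "levi_action (a ** g) (d ** g) t = levi_action a d (\<sigma> g g t)"
  using assms by (simp add: levi_action_mult levi_action_unimodular)

text \<open>
  For \<open>g = block a b c d\<close> with \<open>c\<close> invertible,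
  \<open>g = block s a 0 c ** block 0 (mat 1) (mat 1) u\<close>, where \<open>s = b - a c\<^sup>-\<^sup>1 d\<close> and
  \<open>u = c\<^sup>-\<^sup>1 d\<close>: these are the coordinates of the open double coset of the parabolic and \<open>N\<close>.
\<close>

definition schur :: "'a ^ ('n + 'n) ^ ('n + 'n) \<Rightarrow> 'a ^ 'n ^ 'n" where
  "schur g = upper_right g - upper_left g ** (matrix_inv (lower_left g) ** lower_right g)"

definition unip_coord :: "'a ^ ('n + 'n) ^ ('n + 'n) \<Rightarrow> 'a ^ 'n ^ 'n" where
  "unip_coord g = matrix_inv (lower_left g) ** lower_right g"

definition big_cell :: "('a ^ ('n + 'n) ^ ('n + 'n)) set" where
  "big_cell = {g. lower_left g \<in> GL \<and> schur g \<in> GL}"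

text \<open>
  The equivariant function that vanishes outside the points of the open orbit with unipotent
  coordinate in \<open>L\<close> and takes the value \<open>t\<close> at every \<open>block 0 (mat 1) (mat 1) u\<close> with \<open>u\<close> in \<open>L\<close>.
\<close>

definition cell_section ::
  "('a ^ 'n ^ 'n) set \<Rightarrow> ('v, 'w) tensor \<Rightarrow> 'a ^ ('n + 'n) ^ ('n + 'n) \<Rightarrow> ('v, 'w) tensor" where
  "cell_section L t g =
     (if g \<in> big_cell \<and> unip_coord g \<in> L then levi_action (schur g) (lower_left g) t else 0)"

abbreviation weyl_unip :: "'a ^ 'n ^ 'n \<Rightarrow> 'a ^ ('n + 'n) ^ ('n + 'n)" where
  "weyl_unip u \<equiv> block 0 (mat 1) (mat 1) u"

lemma weyl_unip_mult_unip: "weyl_unip u ** unip x = weyl_unip (u + x)"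
  by (simp add: block_mult add.commute)

lemma weyl_unip_coords [simp]:
  "lower_left (weyl_unip u) = mat 1" "schur (weyl_unip u) = mat 1" "unip_coord (weyl_unip u) = u"
  "weyl_unip u \<in> big_cell"
  by (simp_all add: schur_def unip_coord_def big_cell_def)

lemma cell_section_weyl_unip: "cell_section L t (weyl_unip u) = (if u \<in> L then t else 0)"
  by (simp add: cell_section_def levi_action_unimodular \<sigma>_one)

lemma bruhat:
  assumes "g \<in> big_cell"
  shows "g = block (schur g) (upper_left g) 0 (lower_left g) ** weyl_unip (unip_coord g)"
proof -
  have "lower_left g \<in> GL" using assms by (simp add: big_cell_def)
  then have "block (schur g) (upper_left g) 0 (lower_left g) ** weyl_unip (unip_coord g)
      = block (upper_left g) (upper_right g) (lower_left g) (lower_right g)"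
    by (simp add: block_mult block_eq_iff schur_def unip_coord_def matrix_inv_mult_cancel)
  then show ?thesis by (simp add: block_of_blocks)
qed

lemma weyl_unip_GL: "weyl_unip u \<in> GL"
proof (rule GL_of_right_inverse)
  show "weyl_unip u ** block (- u) (mat 1) (mat 1) 0 = mat 1"
    by (simp add: block_mult block_one)
qed

lemma big_cell_GL: "g \<in> big_cell \<Longrightarrow> g \<in> GL"
  using bruhat[of g] GL_mult[OF block_upper_GL weyl_unip_GL] by (metis (no_types, lifting) big_cell_def mem_Collect_eq)

lemma parabolic_coords:
  fixes a d x :: "'a ^ 'n ^ 'n"
  assumes "a \<in> GL" "d \<in> GL"
  defines "p \<equiv> block a x 0 d"
  shows "lower_left (p ** g) = d ** lower_left g"
    and "p ** g \<in> big_cell \<longleftrightarrow> g \<in> big_cell"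
    and "g \<in> big_cell \<Longrightarrow> schur (p ** g) = a ** schur g"
    and "g \<in> big_cell \<Longrightarrow> unip_coord (p ** g) = unip_coord g"
proof -
  obtain a' b' c' d' where g: "g = block a' b' c' d'" by (rule block_cases)
  show ll: "lower_left (p ** g) = d ** lower_left g" by (simp add: p_def g block_mult)
  have unip: "unip_coord (p ** g) = unip_coord g" if "c' \<in> GL"
    using that assms by (simp add: unip_coord_def g block_mult matrix_inv_mult matrix_inv_mult_cancel
        flip: matrix_mul_assoc)
  have schur: "schur (p ** g) = a ** schur g" if c': "c' \<in> GL"
  proof -
    have "schur (p ** g) = upper_right (p ** g) - upper_left (p ** g) ** unip_coord g"
      using unip[OF c'] by (simp add: schur_def unip_coord_def)
    also have "\<dots> = a ** b' + x ** d' - (a ** a' + x ** c') ** (matrix_inv c' ** d')"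
      by (simp add: p_def g block_mult unip_coord_def)
    also have "(a ** a' + x ** c') ** (matrix_inv c' ** d')
        = a ** (a' ** (matrix_inv c' ** d')) + x ** (c' ** (matrix_inv c' ** d'))"
      by (simp add: matrix_add_rdistrib matrix_mul_assoc)
    also have "x ** (c' ** (matrix_inv c' ** d')) = x ** d'"
      using c' by (simp add: matrix_inv_mult_cancel)
    finally show ?thesis by (simp add: g schur_def matrix_diff_ldistrib)
  qed
  show "g \<in> big_cell \<Longrightarrow> schur (p ** g) = a ** schur g"
    "g \<in> big_cell \<Longrightarrow> unip_coord (p ** g) = unip_coord g"
    using unip schur by (auto simp: big_cell_def g)
  show "p ** g \<in> big_cell \<longleftrightarrow> g \<in> big_cell"
  proof -
    have "lower_left (p ** g) \<in> GL \<longleftrightarrow> lower_left g \<in> GL"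
      unfolding ll using assms(2) by (rule GL_mult_iff)
    moreover have "schur (p ** g) \<in> GL \<longleftrightarrow> schur g \<in> GL" if "lower_left g \<in> GL"
      using schur that assms(1) by (simp add: g GL_mult_iff)
    ultimately show ?thesis by (auto simp: big_cell_def)
  qed
qed

lemma cell_section_parabolic:
  assumes "a \<in> GL" "d \<in> GL"
  shows "cell_section L t (block a x 0 d ** g) = levi_action a d (cell_section L t g)"
proof (cases "g \<in> big_cell")
  case True
  then show ?thesis
    using assms parabolic_coords[OF assms, where x = x and g = g]
    by (auto simp: cell_section_def levi_action_mult clinearD[OF clinear_levi_action] big_cell_def)
next
  case False
  then show ?thesis
    using assms parabolic_coords(2)[OF assms, where x = x and g = g]
    by (simp add: cell_section_def clinearD[OF clinear_levi_action])
qed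

lemma unip_coords:
  "lower_left (g ** unip x) = lower_left g"
  "g ** unip x \<in> big_cell \<longleftrightarrow> g \<in> big_cell"
  "lower_left g \<in> GL \<Longrightarrow> schur (g ** unip x) = schur g"
  "lower_left g \<in> GL \<Longrightarrow> unip_coord (g ** unip x) = unip_coord g + x"
proof -
  obtain a b c d where g: "g = block a b c d" by (rule block_cases)
  show ll: "lower_left (g ** unip x) = lower_left g" by (simp add: g block_mult)
  have u: "unip_coord (g ** unip x) = unip_coord g + x" if "c \<in> GL"
    using that by (simp add: g block_mult unip_coord_def matrix_add_ldistrib matrix_inv_mult_cancel)
  have s: "schur (g ** unip x) = schur g" if "c \<in> GL"
    using that by (simp add: g block_mult schur_def matrix_add_ldistrib matrix_inv_mult_cancel)
  show "lower_left g \<in> GL \<Longrightarrow> schur (g ** unip x) = schur g"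
    "lower_left g \<in> GL \<Longrightarrow> unip_coord (g ** unip x) = unip_coord g + x"
    using s u by (simp_all add: g)
  show "g ** unip x \<in> big_cell \<longleftrightarrow> g \<in> big_cell"
    using s ll by (auto simp: big_cell_def g)
qed

lemma diag_coords:
  assumes "h \<in> GL"
  shows "lower_left (g ** diag_block h) = lower_left g ** h"
    "g ** diag_block h \<in> big_cell \<longleftrightarrow> g \<in> big_cell"
    "lower_left g \<in> GL \<Longrightarrow> schur (g ** diag_block h) = schur g ** h"
    "lower_left g \<in> GL \<Longrightarrow> unip_coord (g ** diag_block h) = matrix_inv h ** unip_coord g ** h"
proof -
  obtain a b c d where g: "g = block a b c d" by (rule block_cases)
  show ll: "lower_left (g ** diag_block h) = lower_left g ** h" by (simp add: g block_mult)
  have u: "unip_coord (g ** diag_block h) = matrix_inv h ** unip_coord g ** h" if "c \<in> GL"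
    using that assms by (simp add: g block_mult unip_coord_def matrix_inv_mult matrix_mul_assoc)
  have s: "schur (g ** diag_block h) = schur g ** h" if c: "c \<in> GL"
  proof -
    have "schur (g ** diag_block h) = b ** h - a ** h ** unip_coord (g ** diag_block h)"
      by (simp add: g block_mult schur_def unip_coord_def)
    also have "\<dots> = b ** h - a ** (h ** (matrix_inv h ** (unip_coord g ** h)))"
      by (simp add: u[OF c] matrix_mul_assoc)
    also have "\<dots> = schur g ** h"
      using assms by (simp add: g schur_def unip_coord_def matrix_diff_rdistrib matrix_inv_mult_cancel
          matrix_mul_assoc)
    finally show ?thesis .
  qed
  show "lower_left g \<in> GL \<Longrightarrow> schur (g ** diag_block h) = schur g ** h"
    "lower_left g \<in> GL \<Longrightarrow> unip_coord (g ** diag_block h) = matrix_inv h ** unip_coord g ** h"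
    using s u by (simp_all add: g)
  show "g ** diag_block h \<in> big_cell \<longleftrightarrow> g \<in> big_cell"
  proof -
    have "lower_left (g ** diag_block h) \<in> GL \<longleftrightarrow> lower_left g \<in> GL"
      unfolding ll using assms by (rule GL_mult_iff)
    moreover have "schur (g ** diag_block h) \<in> GL \<longleftrightarrow> schur g \<in> GL" if "lower_left g \<in> GL"
      using s that assms by (simp add: g GL_mult_iff)
    ultimately show ?thesis by (auto simp: big_cell_def)
  qed
qed

definition lattice :: "('a ^ 'n ^ 'n) set \<Rightarrow> bool" where
  "lattice L \<longleftrightarrow> additive_subgroup L \<and> (\<exists>r>0. mball r \<subseteq> L) \<and> (\<exists>R. L \<subseteq> mball R)"

text \<open>
  The coordinates of \<open>weyl_unip u ** k\<close> are polynomials of degree at most two in \<open>u\<close>, up to the inverse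
  of a matrix close to the identity. So the bound \<open>R * R * \<eta>\<close> on the error is uniform in \<open>u\<close>; this
  uniformity makes the sections smooth.
\<close>

lemma weyl_unip_perturb:
  fixes k :: "'a ^ ('n + 'n) ^ ('n + 'n)"
  assumes k: "k - mat 1 \<in> mball \<eta>" and \<eta>: "0 < \<eta>" "R * R * \<eta> \<le> \<epsilon>" "\<epsilon> < 1" and R: "1 \<le> R"
    and u: "u \<in> mball R"
  defines "g \<equiv> weyl_unip u ** k"
  shows "g \<in> big_cell" "lower_left g - mat 1 \<in> mball \<epsilon>" "schur g - mat 1 \<in> mball \<epsilon>"
    "unip_coord g - u \<in> mball \<epsilon>"
proof -
  obtain k11 k12 k21 k22 where kb: "k = block k11 k12 k21 k22" by (rule block_cases)
  have ks: "k11 - mat 1 \<in> mball \<eta>" "k12 \<in> mball \<eta>" "k21 \<in> mball \<eta>" "k22 - mat 1 \<in> mball \<eta>"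
    using k unfolding kb block_one[symmetric] block_diff block_mball_iff by auto
  have "\<eta> \<le> R * \<eta>" "R * \<eta> \<le> R * R * \<eta>"
    using R \<eta>(1) by (simp_all add: mult_le_cancel_right1)
  with \<eta> have bounds: "\<eta> \<le> R * \<eta>" "R * \<eta> \<le> \<epsilon>" "\<eta> \<le> \<epsilon>" "\<epsilon> \<ge> 0" "R * \<eta> < 1" by linarith+
  have g: "g = block k21 k22 (k11 + u ** k21) (k12 + u ** k22)"
    by (simp add: g_def kb block_mult)
  define c where "c = k11 + u ** k21"
  have uk: "u ** k21 \<in> mball (R * \<eta>)" using u ks(3) R \<eta>(1) by (intro mball_mult) auto
  have "c - mat 1 = (k11 - mat 1) + u ** k21" by (simp add: c_def)
  then have c1: "c - mat 1 \<in> mball (R * \<eta>)"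
    using mball_add[OF mball_mono[OF ks(1) bounds(1)] uk] by (simp only:)
  have cGL: "c \<in> GL" and cinv: "matrix_inv c \<in> mball 1"
    using near_one_GL[OF c1] near_one_inverse[OF c1] bounds R \<eta>(1) by auto
  have k22: "k22 \<in> mball 1" using near_one_integral[OF ks(4)] bounds \<eta>(1) by auto
  have "u ** k22 \<in> mball (R * 1)" using u k22 R by (intro mball_mult) auto
  then have d: "k12 + u ** k22 \<in> mball R"
    using mball_mono[OF ks(2), of R] bounds R \<eta> by (intro mball_add) auto
  have ll: "lower_left g = c" by (simp add: g c_def)
  show "lower_left g - mat 1 \<in> mball \<epsilon>" unfolding ll using c1 bounds(2) by (rule mball_mono)
  have uc: "unip_coord g = matrix_inv c ** (k12 + u ** k22)" by (simp add: unip_coord_def g c_def)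
  have "matrix_inv c ** (k12 + u ** k22) \<in> mball (1 * R)"
    using cinv d R by (intro mball_mult) auto
  then have "k21 ** (matrix_inv c ** (k12 + u ** k22)) \<in> mball (\<eta> * R)"
    using ks(3) R \<eta>(1) by (intro mball_mult) auto
  then have "(k22 - mat 1) - k21 ** (matrix_inv c ** (k12 + u ** k22)) \<in> mball (R * \<eta>)"
    by (intro mball_diff mball_mono[OF ks(4) bounds(1)]) (simp add: mult.commute)
  moreover have "schur g - mat 1 = (k22 - mat 1) - k21 ** (matrix_inv c ** (k12 + u ** k22))"
    by (simp add: schur_def g c_def algebra_simps)
  ultimately have s: "schur g - mat 1 \<in> mball (R * \<eta>)" by (simp only:)
  then show "schur g - mat 1 \<in> mball \<epsilon>" using bounds(2) by (rule mball_mono)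
  have "schur g \<in> GL" using near_one_GL[OF s] bounds R \<eta>(1) by auto
  then show "g \<in> big_cell" using cGL by (simp add: big_cell_def ll)
  have "(k12 + u ** k22) - c ** u = (k12 + u ** (k22 - mat 1)) - ((k11 - mat 1) ** u + u ** k21 ** u)"
    by (simp add: c_def matrix_diff_ldistrib matrix_diff_rdistrib matrix_add_rdistrib)
  moreover have "k12 \<in> mball (R * R * \<eta>)" using ks(2) \<open>R * \<eta> \<le> R * R * \<eta>\<close> bounds by (intro mball_mono[OF ks(2)]) auto
  moreover have "u ** (k22 - mat 1) \<in> mball (R * R * \<eta>)"
    using mball_mult[OF u ks(4)] R \<eta>(1) \<open>R * \<eta> \<le> R * R * \<eta>\<close> by (auto intro: mball_mono)
  moreover have "(k11 - mat 1) ** u \<in> mball (R * R * \<eta>)"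
    using mball_mult[OF ks(1) u] R \<eta>(1) \<open>R * \<eta> \<le> R * R * \<eta>\<close> by (auto intro: mball_mono simp: mult.commute)
  moreover have "u ** k21 ** u \<in> mball (R * R * \<eta>)"
    using mball_mult[OF uk u] R \<eta>(1) by (simp add: mult.commute mult.left_commute)
  ultimately have "(k12 + u ** k22) - c ** u \<in> mball (R * R * \<eta>)"
    by (simp only:) (intro mball_diff mball_add)
  then have "matrix_inv c ** ((k12 + u ** k22) - c ** u) \<in> mball (1 * (R * R * \<eta>))"
    using cinv R \<eta>(1) by (intro mball_mult) auto
  moreover have "matrix_inv c ** ((k12 + u ** k22) - c ** u) = unip_coord g - u"
    using cGL by (simp add: uc matrix_diff_ldistrib matrix_inv_mult_cancel)
  ultimately show "unip_coord g - u \<in> mball \<epsilon>"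
    using \<eta>(2) by (auto intro: mball_mono)
qed

text \<open>
  A small \<open>k\<close> keeps the unipotent coordinate inside its coset of a small ball, hence in \<open>L\<close>, and its
  Levi coordinates have unit determinant and fix \<open>t\<close>. Small elements form a group, so the complement
  of the support is stable as well.
\<close>

lemma cell_section_smooth:
  assumes "lattice L"
  shows "\<exists>r>0. \<forall>k\<in>GL. k - mat 1 \<in> mball r \<longrightarrow>
    right_translation k (cell_section L t) = cell_section L t"
proof -
  obtain e0 R0 where L: "additive_subgroup L" "e0 > 0" "mball e0 \<subseteq> L" "L \<subseteq> mball R0"
    using assms by (auto simp: lattice_def)
  obtain r where r: "r > 0" "\<And>a d. a \<in> GL \<Longrightarrow> d \<in> GL \<Longrightarrow> a - mat 1 \<in> mball r \<Longrightarrow>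
      d - mat 1 \<in> mball r \<Longrightarrow> \<sigma> a d t = t"
    using \<sigma>_near_one by metis
  define R where "R = max R0 1"
  define \<epsilon> where "\<epsilon> = min (min e0 r) (1/2)"
  define \<eta> where "\<eta> = \<epsilon> / (R * R)"
  have R: "1 \<le> R" by (simp add: R_def)
  have LR: "u \<in> mball R" if "u \<in> L" for u
    using that L(4) by (auto simp: R_def intro: mball_mono)
  have \<epsilon>: "0 < \<epsilon>" "\<epsilon> < 1" "\<epsilon> \<le> e0" "\<epsilon> \<le> r" using L(2) r(1) by (auto simp: \<epsilon>_def)
  have \<eta>: "0 < \<eta>" "R * R * \<eta> \<le> \<epsilon>" using R \<epsilon> by (auto simp: \<eta>_def)
  have "\<epsilon> \<le> \<epsilon> * (R * R)" using R \<epsilon>(1) by (simp add: mult_le_cancel_left1 mult_ge1_I)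
  then have "\<eta> \<le> \<epsilon>" using R by (simp add: \<eta>_def divide_le_eq)
  then have "\<eta> < 1" using \<epsilon> by linarith
  have moved: "g ** k \<in> big_cell \<and> unip_coord (g ** k) \<in> L \<and>
      cell_section L t (g ** k) = cell_section L t g"
    if g: "g \<in> big_cell" "unip_coord g \<in> L" and k: "k - mat 1 \<in> mball \<eta>" for g k
  proof -
    let ?u = "unip_coord g" and ?p = "block (schur g) (upper_left g) 0 (lower_left g)"
    let ?h = "weyl_unip ?u ** k"
    have GL: "schur g \<in> GL" "lower_left g \<in> GL" using g by (auto simp: big_cell_def)
    have gk: "g ** k = ?p ** ?h" using bruhat[OF g(1)] by (metis matrix_mul_assoc)
    note h = weyl_unip_perturb[OF k \<eta> \<epsilon>(2) R LR[OF g(2)]]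
    note pc = parabolic_coords[OF GL, where x = "upper_left g" and g = ?h]
    have "?h \<in> big_cell" by (rule h)
    have "unip_coord ?h - ?u \<in> L" using h(4) \<epsilon>(3) L(3) by (auto intro: mball_mono)
    then have uL: "unip_coord ?h \<in> L" using additive_subgroupD(4)[OF L(1) _ g(2)] by fastforce
    have hGL: "schur ?h \<in> GL" "lower_left ?h \<in> GL" using h(1) by (auto simp: big_cell_def)
    have "fabs (det (schur ?h)) = 1" "fabs (det (lower_left ?h)) = 1"
      using near_one_det[OF h(3)] near_one_det[OF h(2)] \<epsilon> by auto
    moreover have "\<sigma> (schur ?h) (lower_left ?h) t = t"
      using r(2)[OF hGL mball_mono[OF h(3)] mball_mono[OF h(2)]] \<epsilon> by simp
    ultimately have "cell_section L t ?h = t"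
      using h(1) uL hGL by (simp add: cell_section_def levi_action_unimodular)
    moreover have "cell_section L t (weyl_unip ?u) = t"
      using g(2) by (simp add: cell_section_weyl_unip)
    ultimately have "cell_section L t (g ** k) = cell_section L t g"
      unfolding gk cell_section_parabolic[OF GL]
      using bruhat[OF g(1)] cell_section_parabolic[OF GL] by metis
    then show ?thesis using h(1) uL pc(2,4) by (simp add: gk)
  qed
  have "cell_section L t (g ** k) = cell_section L t g"
    if k: "k \<in> GL" "k - mat 1 \<in> mball \<eta>" for g k
  proof (cases "g \<in> big_cell \<and> unip_coord g \<in> L")
    case True
    then show ?thesis using moved k by blast
  next
    case False
    have "matrix_inv k \<in> mball 1" using near_one_inverse[OF k(2)] \<open>\<eta> < 1\<close> \<eta>(1) by simp
    moreover have "matrix_inv k - mat 1 = - (matrix_inv k ** (k - mat 1))"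
      using k(1) by (simp add: matrix_diff_ldistrib matrix_inv_left)
    ultimately have kinv: "matrix_inv k - mat 1 \<in> mball \<eta>"
      using mball_mult[of "matrix_inv k" 1 "k - mat 1" \<eta>] k(2) \<eta>(1) by simp
    have "g ** k ** matrix_inv k = g" using k(1) by (rule matrix_inv_mult_cancel)
    then have "\<not> (g ** k \<in> big_cell \<and> unip_coord (g ** k) \<in> L)"
      using False moved[of "g ** k" "matrix_inv k"] kinv by auto
    then show ?thesis using False by (auto simp: cell_section_def)
  qed
  then show ?thesis using \<eta>(1) by (intro exI[of _ \<eta>]) (auto simp: right_translation_def)
qed

lemma cell_section_in_ind: "lattice L \<Longrightarrow> cell_section L t \<in> ind"
  using cell_section_parabolic[of _ _ L t] cell_section_smooth[of L t] big_cell_GL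
  unfolding parabolic_ind_def mem_Collect_eq smooth_iff_near_one
  by (auto simp: cell_section_def levi_action_def)

section \<open>The kernel of the twisted Jacquet functor\<close>

lemma ind_translation:
  assumes h: "h \<in> GL" and f: "f \<in> ind"
  shows "right_translation h f \<in> ind"
proof -
  have zero: "f g = 0" if "g \<notin> GL" for g
    using f that by (simp add: parabolic_ind_def)
  have equiv: "f (block a x 0 d ** g) = complex_of_real (sqrt (modular_char a d)) *\<^sub>C \<sigma> a d (f g)"
    if "a \<in> GL" "d \<in> GL" "g \<in> GL" for a d x g
    using f that by (simp add: parabolic_ind_def)
  from f obtain r where "r > 0"
    "\<And>k. k \<in> GL \<Longrightarrow> k - mat 1 \<in> mball r \<Longrightarrow> right_translation k f = f"
    unfolding parabolic_ind_def mem_Collect_eq smooth_iff_near_one by blast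
  from smooth_right_translation[OF h this]
  have "openin (top_of_set GL) {k \<in> GL. right_translation k (right_translation h f) = right_translation h f}"
    unfolding smooth_iff_near_one .
  moreover have "g ** h \<notin> GL" if "g \<notin> GL" for g
    using that h by (auto simp: GL_def invertible_det_nz det_mul)
  ultimately show ?thesis
    unfolding parabolic_ind_def mem_Collect_eq
    using zero equiv GL_mult[OF _ h] by (simp add: right_translation_def flip: matrix_mul_assoc)
qed

lemma kernel_subspace:
  "0 \<in> kernel" "f \<in> kernel \<Longrightarrow> f' \<in> kernel \<Longrightarrow> f + f' \<in> kernel"
  "f \<in> kernel \<Longrightarrow> f' \<in> kernel \<Longrightarrow> f - f' \<in> kernel" "f \<in> kernel \<Longrightarrow> c *\<^sub>C f \<in> kernel"
  "(\<And>s. s \<in> S \<Longrightarrow> F s \<in> kernel) \<Longrightarrow> (\<Sum>s\<in>S. F s) \<in> kernel"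
  unfolding jacquet_kernel_def
  by (auto intro: complex_vector.span_zero complex_vector.span_add complex_vector.span_diff
      complex_vector.span_scale complex_vector.span_sum)

lemma kernel_generator:
  "f \<in> ind \<Longrightarrow> right_translation (unip x) f - \<psi> (trace x) *\<^sub>C f \<in> kernel"
  unfolding jacquet_kernel_def by (rule complex_vector.span_base) blast

text \<open>Conjugation by the diagonal group preserves \<open>N\<close> and its character, as the trace is invariant.\<close>

lemma kernel_diag:
  assumes g: "g \<in> GL" and "f \<in> kernel"
  shows "right_translation (diag_block g) f \<in> kernel"
  using assms(2) unfolding jacquet_kernel_def
proof (induction rule: complex_vector.span_induct_alt)
  case base
  show ?case
    unfolding clinearD(4)[OF clinear_right_translation] by (rule complex_vector.span_zero)
next
  case (step c y z)
  then obtain x v where y: "y = right_translation (unip x) v - \<psi> (trace x) *\<^sub>C v" and v: "v \<in> ind"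
    by blast
  let ?v = "right_translation (diag_block g) v"
  have "right_translation (diag_block g) y
      = right_translation (unip (g ** x ** matrix_inv g)) ?v - \<psi> (trace (g ** x ** matrix_inv g)) *\<^sub>C ?v"
    unfolding y right_translation_diff right_translation_scale trace_conj[OF g]
    by (simp flip: right_translation_mult add: diag_block_unip[OF g])
  moreover have "?v \<in> ind" using ind_translation[OF diag_block_GL[OF g] v] .
  ultimately have "right_translation (diag_block g) y \<in> kernel" using kernel_generator by simp
  then have "c *\<^sub>C right_translation (diag_block g) y + right_translation (diag_block g) z \<in> kernel"
    using step.IH kernel_subspace(2,4) unfolding jacquet_kernel_def by blast
  then show ?case
    by (simp only: right_translation_add right_translation_scale jacquet_kernel_def)
qed

lemma cell_section_add: "cell_section L (s + t) = cell_section L s + cell_section L t"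
  by (auto simp: fun_eq_iff cell_section_def big_cell_def clinearD[OF clinear_levi_action])

lemma cell_section_scale: "cell_section L (c *\<^sub>C t) = c *\<^sub>C cell_section L t"
  by (auto simp: fun_eq_iff cell_section_def big_cell_def scaleC_fun_def clinearD[OF clinear_levi_action])

lemma cell_section_unip:
  "right_translation (unip x) (cell_section L t) g =
    (if g \<in> big_cell \<and> unip_coord g + x \<in> L then levi_action (schur g) (lower_left g) t else 0)"
  using unip_coords[of g x] by (auto simp: right_translation_def cell_section_def big_cell_def)

lemma cell_section_transversal:
  assumes S: "transversal S L L'" and L: "additive_subgroup L" and "L' \<subseteq> L"
  shows "cell_section L t = (\<Sum>s\<in>S. right_translation (unip (- s)) (cell_section L' t))"
proof
  fix g
  let ?u = "unip_coord g" and ?x = "levi_action (schur g) (lower_left g) t"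
  have fin: "finite S" and SL: "S \<subseteq> L" using S by (auto simp: transversal_def)
  have sum_apply: "(\<Sum>s\<in>S. right_translation (unip (- s)) (cell_section L' t)) g
      = (\<Sum>s\<in>S. if g \<in> big_cell \<and> ?u - s \<in> L' then ?x else 0)"
    using fin by (induction S) (simp_all add: cell_section_unip)
  show "cell_section L t g = (\<Sum>s\<in>S. right_translation (unip (- s)) (cell_section L' t)) g"
  proof (cases "g \<in> big_cell \<and> ?u \<in> L")
    case True
    then have "\<exists>!s. s \<in> S \<and> ?u - s \<in> L'" using S by (simp add: transversal_def)
    then obtain s0 where s0: "s0 \<in> S" "\<And>s. s \<in> S \<Longrightarrow> ?u - s \<in> L' \<longleftrightarrow> s = s0" by blast
    have "(\<Sum>s\<in>S. if g \<in> big_cell \<and> ?u - s \<in> L' then ?x else 0) = (\<Sum>s\<in>S. if s = s0 then ?x else 0)"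
      using True s0 by (intro sum.cong) auto
    also have "\<dots> = ?x" using fin s0(1) by simp
    finally show ?thesis using True by (simp add: sum_apply cell_section_def)
  next
    case False
    have "?u - s \<notin> L'" if "g \<in> big_cell" "s \<in> S" for s
    proof
      assume "?u - s \<in> L'"
      then have "?u - s + s \<in> L" using additive_subgroupD(4)[OF L] SL \<open>L' \<subseteq> L\<close> that by blast
      then show False using False that by simp
    qed
    then have "(\<Sum>s\<in>S. if g \<in> big_cell \<and> ?u - s \<in> L' then ?x else 0) = 0"
      by (intro sum.neutral) auto
    then show ?thesis using False by (auto simp: sum_apply cell_section_def)
  qed
qed

text \<open>
  Modulo the kernel, translates by elements on which the character is trivial agree. Hence the class
  of a section is proportional to the number of cosets of a small lattice in its support.
\<close>

lemma cell_section_refine: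
  assumes S: "transversal S L L'" and L: "additive_subgroup L" and L': "L' \<subseteq> L" "lattice L'"
    and triv: "\<And>x. x \<in> L \<Longrightarrow> \<psi> (trace x) = 1"
  shows "cell_section L t - of_nat (card S) *\<^sub>C cell_section L' t \<in> kernel"
proof -
  let ?f = "cell_section L' t"
  have "right_translation (unip (- s)) ?f - ?f \<in> kernel" if "s \<in> S" for s
  proof -
    have "s \<in> L" using that S by (auto simp: transversal_def)
    then have "\<psi> (trace (- s)) = 1" using triv additive_subgroupD(3)[OF L] by blast
    then show ?thesis
      using kernel_generator[OF cell_section_in_ind[OF L'(2)], of "- s" t] by (simp add: scaleC_one)
  qed
  then have "(\<Sum>s\<in>S. right_translation (unip (- s)) ?f - ?f) \<in> kernel" by (rule kernel_subspace)
  then show ?thesis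
    unfolding cell_section_transversal[OF S L L'(1)] sum_subtractf
    by (simp only: complex_vector.sum_constant_scale)
qed

section \<open>Twisted sums along the unipotent radical\<close>

lemma character_trivial_radius: "\<exists>r>0. \<forall>x. fabs x \<le> r \<longrightarrow> \<psi> x = 1"
  using additive_character_trivial_on_ball[OF \<psi>] .

text \<open>
  A radius on whose ball the character is trivial. As the trace is invariant under conjugation, the
  character of \<open>N\<close> is then trivial on all conjugates of the lattice \<open>L0\<close> below.
\<close>

definition r0 :: real where
  "r0 = (SOME r. r > 0 \<and> (\<forall>x. fabs x \<le> r \<longrightarrow> \<psi> x = 1))"

lemma r0_pos: "r0 > 0" and r0: "fabs x \<le> r0 \<Longrightarrow> \<psi> x = 1"
  using someI_ex[OF character_trivial_radius] by (auto simp: r0_def)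

abbreviation L0 :: "('a ^ 'n ^ 'n) set" where "L0 \<equiv> mball r0"

lemma \<psi>_trace_L0: "x \<in> L0 \<Longrightarrow> \<psi> (trace x) = 1"
  unfolding trace_def by (rule r0, rule fabs_sum_bound) (use r0_pos in \<open>auto simp: mball_def\<close>)

lemma \<psi>_add: "\<psi> (x + y) = \<psi> x * \<psi> y"
  using \<psi> by (simp add: nontrivial_additive_character_def)

lemma lattice_mball: "0 < r \<Longrightarrow> lattice (mball r)"
  by (auto simp: lattice_def additive_subgroup_mball intro: exI[of _ r])

lemma ex_lattice_transversal:
  assumes "lattice L" "0 < \<epsilon>"
  shows "\<exists>S. transversal S L (mball \<epsilon>)"
proof -
  obtain R where R: "L \<subseteq> mball R" using assms(1) by (auto simp: lattice_def)
  obtain F where F: "finite F" "\<forall>x \<in> mball R :: ('a ^ 'n ^ 'n) set. \<exists>y\<in>F. x - y \<in> mball \<epsilon>"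
    using finite_cover_mball[OF locally_compact assms(2)] by blast
  show ?thesis
    by (rule ex_transversal[OF additive_subgroup_mball F(1)]) (use F(2) R assms(2) in auto)
qed

text \<open>
  The function \<open>u \<mapsto> \<psi>(- tr u) f(w u)\<close>, with \<open>w\<close> the block permutation, summed over
  representatives; up to a factor this is its integral over a ball.
\<close>

definition twisted_sum ::
  "('a ^ 'n ^ 'n) set \<Rightarrow> ('a ^ ('n + 'n) ^ ('n + 'n) \<Rightarrow> ('v, 'w) tensor) \<Rightarrow> ('v, 'w) tensor" where
  "twisted_sum S f = (\<Sum>s\<in>S. \<psi> (- trace s) *\<^sub>C f (weyl_unip s))"

lemma twisted_sum_add: "twisted_sum S (f + f') = twisted_sum S f + twisted_sum S f'"
  by (simp add: twisted_sum_def scaleC_add_right sum.distrib)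

lemma twisted_sum_scale: "twisted_sum S (c *\<^sub>C f) = c *\<^sub>C twisted_sum S f"
  by (simp add: twisted_sum_def scaleC_fun_def complex_vector.scale_sum_right scaleC_scaleC mult.commute)

lemma twisted_sum_diff: "twisted_sum S (f - f') = twisted_sum S f - twisted_sum S f'"
  using twisted_sum_add[of S "f - f'" f'] by (simp add: algebra_simps)

text \<open>
  Every element of the kernel is annihilated by the twisted sum over all large balls modulo all small
  ones. The radii depend on the element, and quantifying over all further radii makes the property
  pass to linear combinations.
\<close>

definition eventually_killed :: "('a ^ ('n + 'n) ^ ('n + 'n) \<Rightarrow> ('v, 'w) tensor) \<Rightarrow> bool" where
  "eventually_killed f \<longleftrightarrow> (\<exists>R0 \<epsilon>0. 0 < \<epsilon>0 \<and> (\<forall>R \<epsilon> S. R0 \<le> R \<longrightarrow> 0 < \<epsilon> \<longrightarrow> \<epsilon> \<le> \<epsilon>0 \<longrightarrow>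
     transversal S (mball R) (mball \<epsilon>) \<longrightarrow> twisted_sum S f = 0))"

text \<open>
  By smoothness the summand is periodic under a small ball. Once the large ball contains \<open>x\<close>, shifting
  the summation variable by \<open>x\<close> therefore multiplies the twisted sum by \<open>\<psi> (trace x)\<close>.
\<close>

lemma generator_eventually_killed:
  assumes f: "f \<in> ind"
  shows "eventually_killed (right_translation (unip x) f - \<psi> (trace x) *\<^sub>C f)"
proof -
  from f obtain r where r: "r > 0"
    "\<And>k. k \<in> GL \<Longrightarrow> k - mat 1 \<in> mball r \<Longrightarrow> right_translation k f = f"
    unfolding parabolic_ind_def mem_Collect_eq smooth_iff_near_one by blast
  obtain R0 where R0: "1 \<le> R0" "x \<in> mball R0" using ex_mball by blast
  have "twisted_sum S (right_translation (unip x) f - \<psi> (trace x) *\<^sub>C f) = 0"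
    if R: "R0 \<le> R" and \<epsilon>: "0 < \<epsilon>" "\<epsilon> \<le> min r r0" and S: "transversal S (mball R) (mball \<epsilon>)"
    for R \<epsilon> S
  proof -
    let ?F = "\<lambda>s. \<psi> (- trace s) *\<^sub>C f (weyl_unip s)"
    have periodic: "?F (u + y) = ?F u" if y: "y \<in> mball \<epsilon>" for u y
    proof -
      have "unip y - mat 1 \<in> mball r"
        using y \<epsilon> r(1) mball_mono[of y \<epsilon> r]
        unfolding block_one[symmetric] block_diff block_mball_iff by simp
      from r(2)[OF unip_GL this] have f_y: "f (weyl_unip u ** unip y) = f (weyl_unip u)"
        unfolding right_translation_def by metis
      have "\<psi> (trace (- y)) = 1"
        using y \<epsilon> by (intro \<psi>_trace_L0) (auto intro: mball_mono)
      moreover have "- trace (u + y) = - trace u + trace (- y)"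
        by (simp add: trace_def sum.distrib sum_negf)
      ultimately have "\<psi> (- trace (u + y)) = \<psi> (- trace u)"
        by (metis \<psi>_add mult.right_neutral)
      with f_y show ?thesis by (simp add: weyl_unip_mult_unip)
    qed
    have "twisted_sum S (right_translation (unip x) f) = (\<Sum>s\<in>S. \<psi> (trace x) *\<^sub>C ?F (s + x))"
      unfolding twisted_sum_def
    proof (intro sum.cong refl)
      fix s
      have "\<psi> (trace x) * \<psi> (- trace (s + x)) = \<psi> (- trace s)"
        unfolding \<psi>_add[symmetric] by (simp add: trace_add)
      then show "\<psi> (- trace s) *\<^sub>C right_translation (unip x) f (weyl_unip s) = \<psi> (trace x) *\<^sub>C ?F (s + x)"
        by (simp add: right_translation_def weyl_unip_mult_unip scaleC_scaleC)
    qed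
    also have "\<dots> = \<psi> (trace x) *\<^sub>C (\<Sum>s\<in>S. ?F (s + x))"
      by (simp add: complex_vector.scale_sum_right)
    also have "(\<Sum>s\<in>S. ?F (s + x)) = (\<Sum>s\<in>S. ?F s)"
      using periodic R R0 \<epsilon>
      by (intro transversal_sum_shift[OF S]) (auto intro: additive_subgroup_mball mball_mono)
    finally show ?thesis by (simp add: twisted_sum_diff twisted_sum_scale) (simp add: twisted_sum_def)
  qed
  then show ?thesis
    unfolding eventually_killed_def using r(1) r0_pos by (intro exI[of _ R0] exI[of _ "min r r0"]) auto
qed

lemma kernel_eventually_killed: "f \<in> kernel \<Longrightarrow> eventually_killed f"
  unfolding jacquet_kernel_def
proof (induction rule: complex_vector.span_induct_alt)
  case base
  show ?case by (auto simp: eventually_killed_def twisted_sum_def intro: exI[of _ 1])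
next
  case (step c x y)
  from step(1) have "eventually_killed x" using generator_eventually_killed by blast
  then obtain R \<epsilon> where x: "0 < \<epsilon>" "\<And>R' \<epsilon>' S. R \<le> R' \<Longrightarrow> 0 < \<epsilon>' \<Longrightarrow> \<epsilon>' \<le> \<epsilon> \<Longrightarrow>
      transversal S (mball R') (mball \<epsilon>') \<Longrightarrow> twisted_sum S x = 0"
    unfolding eventually_killed_def by blast
  from step(2) obtain R1 \<epsilon>1 where y: "0 < \<epsilon>1" "\<And>R' \<epsilon>' S. R1 \<le> R' \<Longrightarrow> 0 < \<epsilon>' \<Longrightarrow> \<epsilon>' \<le> \<epsilon>1 \<Longrightarrow>
      transversal S (mball R') (mball \<epsilon>') \<Longrightarrow> twisted_sum S y = 0"
    unfolding eventually_killed_def by blast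
  have "twisted_sum S (c *\<^sub>C x + y) = 0"
    if "max R R1 \<le> R'" "0 < \<epsilon>'" "\<epsilon>' \<le> min \<epsilon> \<epsilon>1" "transversal S (mball R') (mball \<epsilon>')" for R' \<epsilon>' S
    using x(2)[of R' \<epsilon>' S] y(2)[of R' \<epsilon>' S] that by (simp add: twisted_sum_add twisted_sum_scale)
  then show ?case unfolding eventually_killed_def using x(1) y(1)
    by (intro exI[of _ "max R R1"] exI[of _ "min \<epsilon> \<epsilon>1"]) auto
qed

text \<open>
  The twisted sum of the section is \<open>t\<close> times the number of representatives in \<open>L0\<close>, which is positive
  because one of them represents the coset of zero.
\<close>

lemma cell_section_kernel_imp_zero:
  assumes "cell_section L0 t \<in> kernel"
  shows "t = 0"
proof -
  obtain R0 \<epsilon>0 where E: "0 < \<epsilon>0" "\<And>R \<epsilon> S. R0 \<le> R \<Longrightarrow> 0 < \<epsilon> \<Longrightarrow> \<epsilon> \<le> \<epsilon>0 \<Longrightarrow>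
      transversal S (mball R) (mball \<epsilon>) \<Longrightarrow> twisted_sum S (cell_section L0 t) = 0"
    using kernel_eventually_killed[OF assms] unfolding eventually_killed_def by blast
  define R where "R = max R0 1"
  define \<epsilon> where "\<epsilon> = min \<epsilon>0 r0"
  have \<epsilon>: "0 < \<epsilon>" "\<epsilon> \<le> \<epsilon>0" "\<epsilon> \<le> r0" using E(1) r0_pos by (auto simp: \<epsilon>_def)
  have R: "R0 \<le> R" "0 < R" by (auto simp: R_def)
  obtain S :: "('a ^ 'n ^ 'n) set" where S: "transversal S (mball R) (mball \<epsilon>)"
    using ex_lattice_transversal[OF lattice_mball[OF R(2)] \<epsilon>(1)] by blast
  then have fin: "finite S" by (simp add: transversal_def)
  have "0 = twisted_sum S (cell_section L0 t)" using E(2)[OF R(1) \<epsilon>(1,2) S] by simp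
  also have "\<dots> = (\<Sum>s\<in>S. if s \<in> L0 then t else 0)"
  proof -
    have "\<psi> (- trace s) = 1" if "s \<in> L0" for s
      using \<psi>_trace_L0[of "- s"] that by (simp add: trace_def sum_negf)
    then show ?thesis
      unfolding twisted_sum_def by (intro sum.cong) (auto simp: cell_section_weyl_unip scaleC_one)
  qed
  also have "\<dots> = of_nat (card (S \<inter> L0)) *\<^sub>C t"
    using fin by (simp add: sum.If_cases complex_vector.sum_constant_scale)
  finally have eq: "of_nat (card (S \<inter> L0)) *\<^sub>C t = 0" by simp
  have "0 \<in> mball R" using R by simp
  then obtain s where s: "s \<in> S" "0 - s \<in> mball \<epsilon>" using S unfolding transversal_def by blast
  then have "s \<in> S \<inter> L0" using \<epsilon>(3) mball_mono by auto
  then have "card (S \<inter> L0) \<noteq> 0" using fin by auto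
  then show ?thesis using eq by simp
qed

section \<open>Unimodularity of conjugation\<close>

definition conjugate :: "'a ^ 'n ^ 'n \<Rightarrow> 'a ^ 'n ^ 'n \<Rightarrow> 'a ^ 'n ^ 'n" where
  "conjugate h x = h ** x ** matrix_inv h"

lemma conjugate_mem_iff:
  assumes "h \<in> GL"
  shows "u \<in> conjugate h ` L \<longleftrightarrow> matrix_inv h ** u ** h \<in> L"
proof
  assume "u \<in> conjugate h ` L"
  then show "matrix_inv h ** u ** h \<in> L"
    using assms by (auto simp: conjugate_def matrix_mul_assoc matrix_inv_left matrix_inv_mult_cancel)
next
  assume "matrix_inv h ** u ** h \<in> L"
  moreover have "u = conjugate h (matrix_inv h ** u ** h)"
    using assms by (simp add: conjugate_def matrix_mul_assoc matrix_inv_right matrix_inv_mult_cancel)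
  ultimately show "u \<in> conjugate h ` L" by blast
qed

lemma lattice_conjugate:
  assumes h: "h \<in> GL" and L: "lattice L"
  shows "lattice (conjugate h ` L)"
proof -
  obtain r R where r: "additive_subgroup L" "0 < r" "mball r \<subseteq> L" "L \<subseteq> mball R"
    using L by (auto simp: lattice_def)
  obtain s where s: "s \<ge> 1" "h \<in> mball s" using ex_mball by blast
  obtain s' where s': "s' \<ge> 1" "matrix_inv h \<in> mball s'" using ex_mball by blast
  have "additive_subgroup (conjugate h ` L)"
    using additive_subgroupD[OF r(1)]
    by (auto simp: additive_subgroup_def conjugate_mem_iff[OF h] matrix_diff_ldistrib matrix_diff_rdistrib)
  moreover have "mball (r / (s' * s)) \<subseteq> conjugate h ` L"
  proof
    fix x :: "'a ^ 'n ^ 'n" assume "x \<in> mball (r / (s' * s))"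
    then have "matrix_inv h ** x ** h \<in> mball (s' * (r / (s' * s)) * s)"
      using s s' r(2) by (intro mball_mult) auto
    moreover have "s' * (r / (s' * s)) * s = r" using s(1) s'(1) by simp
    ultimately show "x \<in> conjugate h ` L" using r(3) by (auto simp: conjugate_mem_iff[OF h])
  qed
  moreover have "conjugate h ` L \<subseteq> mball (s * max R 0 * s')"
    unfolding conjugate_def using s s' r(4) by (auto intro!: mball_mult intro: mball_mono)
  moreover have "0 < r / (s' * s)" using r(2) s(1) s'(1) by simp
  ultimately show ?thesis unfolding lattice_def by blast
qed

text \<open>\<open>diag_block h\<close> commutes with the block permutation and normalizes \<open>N\<close>, so the support is conjugated.\<close>

lemma cell_section_diag:
  assumes h: "h \<in> GL"
  shows "right_translation (diag_block h) (cell_section L t) = cell_section (conjugate h ` L) (\<sigma> h h t)"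
proof
  fix g
  show "right_translation (diag_block h) (cell_section L t) g = cell_section (conjugate h ` L) (\<sigma> h h t) g"
    using diag_coords[OF h, of g] levi_action_diagonal[of "schur g" "lower_left g" h t] h
    by (auto simp: right_translation_def cell_section_def conjugate_mem_iff big_cell_def)
qed

text \<open>
  Translation by \<open>diag_block g\<close> carries the class of the section with value \<open>t\<close> to \<open>c\<close> times the class
  of the section with value \<open>g t\<close>; the factor \<open>c\<close> is the modulus of conjugation by \<open>g\<close>.
\<close>

definition scales_by :: "'a ^ 'n ^ 'n \<Rightarrow> real \<Rightarrow> bool" where
  "scales_by g c \<longleftrightarrow> (\<forall>t. right_translation (diag_block g) (cell_section L0 t)
     - complex_of_real c *\<^sub>C cell_section L0 (\<sigma> g g t) \<in> kernel)"

lemma scales_by_mult: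
  assumes "g \<in> GL" "h \<in> GL" "scales_by g c" "scales_by h d"
  shows "scales_by (g ** h) (c * d)"
  unfolding scales_by_def
proof
  fix t
  let ?g = "right_translation (diag_block g)" and ?h = "right_translation (diag_block h)"
  let ?t = "\<sigma> h h t"
  have "?h (cell_section L0 t) - complex_of_real d *\<^sub>C cell_section L0 ?t \<in> kernel"
    using assms(4) by (simp add: scales_by_def)
  then have 1: "?g (?h (cell_section L0 t)) - complex_of_real d *\<^sub>C ?g (cell_section L0 ?t) \<in> kernel"
    using kernel_diag[OF assms(1)] by (simp flip: right_translation_diff right_translation_scale)
  have "?g (cell_section L0 ?t) - complex_of_real c *\<^sub>C cell_section L0 (\<sigma> g g ?t) \<in> kernel"
    using assms(3) by (simp add: scales_by_def)
  from kernel_subspace(2)[OF 1 kernel_subspace(4)[OF this, of "complex_of_real d"]]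
  show "right_translation (diag_block (g ** h)) (cell_section L0 t)
     - complex_of_real (c * d) *\<^sub>C cell_section L0 (\<sigma> (g ** h) (g ** h) t) \<in> kernel"
    using assms(1,2)
    by (simp add: \<sigma>_mult diag_block_mult[symmetric] right_translation_mult scaleC_scaleC
        complex_vector.scale_right_diff_distrib mult.commute)
qed

lemma transversal_card_pos: "transversal S L L' \<Longrightarrow> 0 \<in> L \<Longrightarrow> 0 < card S"
  by (auto simp: transversal_def card_gt_0_iff)

text \<open>
  Both \<open>L0\<close> and its conjugate are compared with a ball contained in the two of them; the factor is the
  quotient of the indices.
\<close>

lemma scales_by_index:
  assumes g: "g \<in> GL" and \<epsilon>: "0 < \<epsilon>" "mball \<epsilon> \<subseteq> L0" "mball \<epsilon> \<subseteq> conjugate g ` L0"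
    and S0: "transversal S0 L0 (mball \<epsilon>)" and S1: "transversal S1 (conjugate g ` L0) (mball \<epsilon>)"
  shows "scales_by g (real (card S1) / real (card S0))"
  unfolding scales_by_def
proof
  fix t
  let ?n0 = "of_nat (card S0) :: complex" and ?n1 = "of_nat (card S1) :: complex"
  let ?t = "\<sigma> g g t"
  have L0: "additive_subgroup L0" "additive_subgroup (conjugate g ` L0)"
    using lattice_conjugate[OF g lattice_mball[OF r0_pos]] lattice_mball[OF r0_pos]
    unfolding lattice_def by auto
  have "?n0 \<noteq> 0" using transversal_card_pos[OF S0] r0_pos by simp
  have 0: "cell_section L0 ?t - ?n0 *\<^sub>C cell_section (mball \<epsilon>) ?t \<in> kernel"
    by (rule cell_section_refine[OF S0 L0(1) \<epsilon>(2) lattice_mball[OF \<epsilon>(1)] \<psi>_trace_L0])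
  have 1: "cell_section (conjugate g ` L0) ?t - ?n1 *\<^sub>C cell_section (mball \<epsilon>) ?t \<in> kernel"
    by (rule cell_section_refine[OF S1 L0(2) \<epsilon>(3) lattice_mball[OF \<epsilon>(1)]])
      (auto simp: conjugate_def trace_conj[OF g] \<psi>_trace_L0)
  have "(?n1 / ?n0) *\<^sub>C (cell_section L0 ?t - ?n0 *\<^sub>C cell_section (mball \<epsilon>) ?t)
      = (?n1 / ?n0) *\<^sub>C cell_section L0 ?t - ?n1 *\<^sub>C cell_section (mball \<epsilon>) ?t"
    using \<open>?n0 \<noteq> 0\<close> by (simp add: complex_vector.scale_right_diff_distrib scaleC_scaleC)
  with kernel_subspace(3)[OF 1 kernel_subspace(4)[OF 0, of "?n1 / ?n0"]]
  show "right_translation (diag_block g) (cell_section L0 t)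
     - complex_of_real (real (card S1) / real (card S0)) *\<^sub>C cell_section L0 (\<sigma> g g t) \<in> kernel"
    by (simp add: cell_section_diag[OF g])
qed

text \<open>
  Transposition maps the lattice \<open>g L0 g\<^sup>-\<^sup>1\<close> to the conjugate of \<open>L0\<close> by the inverse transpose of
  \<open>g\<close> and preserves the balls, so \<open>g\<close> and its inverse transpose have the same index.
\<close>

lemma scales_by_inverse_transpose:
  assumes g: "g \<in> GL"
  shows "\<exists>c>0. scales_by g c \<and> scales_by (transpose (matrix_inv g)) c"
proof -
  let ?g' = "transpose (matrix_inv g)"
  have g'_right: "?g' ** transpose g = mat 1"
    using g by (simp add: matrix_transpose_mul[symmetric] matrix_inv_right transpose_mat)
  have g': "?g' \<in> GL" using g'_right by (rule GL_of_right_inverse)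
  have g'_inv: "matrix_inv ?g' = transpose g" using g'_right by (rule matrix_inv_unique)
  have image_mball: "transpose ` (mball r :: ('a ^ 'n ^ 'n) set) = mball r" for r
    by (auto simp: image_iff intro!: bexI[of _ "transpose x" for x])
  have "transpose (conjugate g x) = conjugate ?g' (transpose x)" for x
    by (simp add: conjugate_def g'_inv matrix_transpose_mul matrix_mul_assoc)
  then have "transpose ` conjugate g ` L0 = conjugate ?g' ` transpose ` L0"
    by (simp add: image_image)
  then have conj_transpose: "transpose ` conjugate g ` L0 = conjugate ?g' ` L0" by (simp only: image_mball)
  obtain e where e: "0 < e" "mball e \<subseteq> conjugate g ` L0"
    using lattice_conjugate[OF g lattice_mball[OF r0_pos]] by (auto simp: lattice_def)
  define \<epsilon> where "\<epsilon> = min e r0"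
  have "0 < \<epsilon>" "\<epsilon> \<le> e" "\<epsilon> \<le> r0" using e(1) r0_pos by (auto simp: \<epsilon>_def)
  then have \<epsilon>: "0 < \<epsilon>" "mball \<epsilon> \<subseteq> L0" "mball \<epsilon> \<subseteq> conjugate g ` L0"
    using e(2) mball_mono by blast+
  have \<epsilon>': "mball \<epsilon> \<subseteq> conjugate ?g' ` L0"
    using image_mono[OF \<epsilon>(3), of transpose] by (simp only: image_mball conj_transpose)
  obtain S0 where S0: "transversal S0 L0 (mball \<epsilon>)"
    using ex_lattice_transversal[OF lattice_mball[OF r0_pos] \<epsilon>(1)] by blast
  obtain S1 where S1: "transversal S1 (conjugate g ` L0) (mball \<epsilon>)"
    using ex_lattice_transversal[OF lattice_conjugate[OF g lattice_mball[OF r0_pos]] \<epsilon>(1)] by blast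
  have bij: "bij (transpose :: 'a ^ 'n ^ 'n \<Rightarrow> _)"
    by (rule o_bij[of transpose]) (auto simp: fun_eq_iff)
  have "transpose (x - y) = transpose x - transpose y" for x y :: "'a ^ 'n ^ 'n"
    by (simp add: transpose_def vec_eq_iff)
  from transversal_image[OF S1 bij this]
  have S1': "transversal (transpose ` S1) (conjugate ?g' ` L0) (mball \<epsilon>)"
    by (simp only: conj_transpose image_mball)
  have card: "card (transpose ` S1) = card S1"
    by (rule card_image) (meson bij bij_is_inj inj_on_subset subset_UNIV)
  let ?c = "real (card S1) / real (card S0)"
  have "(0::'a ^ 'n ^ 'n) \<in> conjugate g ` L0" using \<epsilon> by auto
  then have "0 < card S1" "0 < card S0"
    using transversal_card_pos[OF S1] transversal_card_pos[OF S0] r0_pos by auto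
  then have "0 < ?c" by simp
  then show ?thesis
    using scales_by_index[OF g \<epsilon> S0 S1] scales_by_index[OF g' \<epsilon>(1,2) \<epsilon>' S0 S1'] card by auto
qed

end

locale nonzero_induction_data = induction_data \<rho>1 \<rho>2 \<psi>
  for \<rho>1 :: "'a::nonarch_valued_field ^ 'n ^ 'n \<Rightarrow> 'v::complex_vector \<Rightarrow> 'v"
    and \<rho>2 :: "'a ^ 'n ^ 'n \<Rightarrow> 'w::complex_vector \<Rightarrow> 'w"
    and \<psi> :: "'a \<Rightarrow> complex" +
  assumes nonzero1: "\<exists>v::'v. v \<noteq> 0" and nonzero2: "\<exists>w::'w. w \<noteq> 0"
begin

lemma ex_nonzero_tensor: "\<exists>t :: ('v, 'w) tensor. t \<noteq> 0"
  using nonzero1 nonzero2 pure_tensor_nonzero by blast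

text \<open>
  Composing the two translations multiplies the class of a nonzero section by \<open>c * c\<close>; as the class is
  nonzero, \<open>c * c = 1\<close>.
\<close>

lemma scales_by_one:
  assumes "g \<in> GL" "g' \<in> GL" "g ** g' = mat 1" "scales_by g c" "scales_by g' c" "0 < c"
  shows "scales_by g 1"
proof -
  obtain t :: "('v, 'w) tensor" where "t \<noteq> 0" using ex_nonzero_tensor by blast
  have "scales_by (mat 1) (c * c)" using scales_by_mult[OF assms(1,2,4,5)] assms(3) by simp
  then have "cell_section L0 t - complex_of_real (c * c) *\<^sub>C cell_section L0 t \<in> kernel"
    by (auto simp: scales_by_def block_one right_translation_one \<sigma>_one)
  moreover have "cell_section L0 t - complex_of_real (c * c) *\<^sub>C cell_section L0 t
      = cell_section L0 ((1 - complex_of_real (c * c)) *\<^sub>C t)"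
    unfolding cell_section_scale
    by (simp add: complex_vector.scale_left_diff_distrib scaleC_one)
  ultimately have "(1 - complex_of_real (c * c)) *\<^sub>C t = 0"
    using cell_section_kernel_imp_zero by metis
  then have "complex_of_real (c * c) = 1" using \<open>t \<noteq> 0\<close> by simp
  then have "c * c = 1" by (metis of_real_eq_1_iff)
  then have "c = 1" using \<open>0 < c\<close> by (simp add: square_eq_1_iff)
  then show ?thesis using assms(4) by simp
qed

text \<open>A diagonal matrix is its own transpose, so its inverse transpose is its inverse.\<close>

lemma scales_by_diagonal:
  assumes g: "g \<in> GL" and "\<And>i j. i \<noteq> j \<Longrightarrow> g $ i $ j = 0"
  shows "scales_by g 1"
proof -
  have "transpose g = g" using assms(2) by (auto simp: transpose_def vec_eq_iff) (metis)
  then have "g ** transpose (matrix_inv g) = transpose (matrix_inv g ** g)"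
    by (simp add: matrix_transpose_mul)
  then have inv: "g ** transpose (matrix_inv g) = mat 1"
    using g by (simp add: matrix_inv_left transpose_mat)
  then have "transpose (matrix_inv g) \<in> GL"
    by (metis GL_of_right_inverse matrix_left_right_inverse)
  then show ?thesis using scales_by_inverse_transpose[OF g] scales_by_one[OF g _ inv] by blast
qed

text \<open>
  An elimination matrix is conjugate to its inverse by a diagonal sign matrix.
\<close>

lemma scales_by_elim:
  assumes "v m = 0"
  shows "scales_by (elim_matrix m v) 1"
proof -
  let ?E = "elim_matrix m v" and ?E' = "elim_matrix m (\<lambda>i. - v i)"
  define D :: "'a ^ 'n ^ 'n" where "D = (\<chi> i j. if i = j then (if i = m then - 1 else 1) else 0)"
  have D_mult: "D ** A = (\<chi> i j. (if i = m then - 1 else 1) * A $ i $ j)"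
    for A :: "'a ^ 'n ^ 'n"
    by (simp add: D_def vec_eq_iff matrix_matrix_mult_def if_distrib[of "\<lambda>x. x * _"] cong: if_cong)
  have DD: "D ** D = mat 1" unfolding D_mult by (simp add: D_def vec_eq_iff mat_def)
  have D: "D \<in> GL" using DD by (rule GL_of_right_inverse)
  have scD: "scales_by D 1" by (rule scales_by_diagonal[OF D]) (simp add: D_def)
  have E: "?E \<in> GL" "?E' \<in> GL" using assms by (auto intro: elim_matrix_GL)
  have "D ** ?E = ?E' ** D"
    unfolding D_mult elim_matrix_mult using assms by (auto simp: D_def elim_matrix_def vec_eq_iff)
  then have DED: "D ** ?E ** D = ?E'" by (simp add: DD flip: matrix_mul_assoc)
  obtain c where c: "0 < c" "scales_by ?E c" using scales_by_inverse_transpose[OF E(1)] by blast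
  have "scales_by (D ** ?E ** D) (1 * c * 1)"
    by (intro scales_by_mult GL_mult D E scD c)
  then have "scales_by ?E' c" by (simp add: DED)
  then show ?thesis using scales_by_one[OF E elim_matrix_inverse(2)[of v m]] assms c by blast
qed

lemma scales_by_GL: "g \<in> GL \<Longrightarrow> scales_by g 1"
proof (induction g rule: GL_induct)
  case (mult A B)
  then show ?case using scales_by_mult[of A B 1 1] by simp
qed (auto intro: scales_by_diagonal scales_by_elim)

section \<open>The embedding\<close>

definition embedding :: "('v, 'w) tensor \<Rightarrow> ('a ^ ('n + 'n) ^ ('n + 'n) \<Rightarrow> ('v, 'w) tensor) set" where
  "embedding t = cell_section L0 t +o kernel"

lemma coset_eq_iff: "f +o kernel = f' +o kernel \<longleftrightarrow> f - f' \<in> kernel"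
proof
  assume "f +o kernel = f' +o kernel"
  moreover have "f \<in> f +o kernel" using kernel_subspace(1) by (force simp: elt_set_plus_def)
  ultimately show "f - f' \<in> kernel" by (auto simp: elt_set_plus_def)
next
  assume d: "f - f' \<in> kernel"
  have "f + k \<in> f' +o kernel" "f' + k \<in> f +o kernel" if "k \<in> kernel" for k
  proof -
    have "f + k = f' + ((f - f') + k)" "f' + k = f + (k - (f - f'))" by simp_all
    then show "f + k \<in> f' +o kernel" "f' + k \<in> f +o kernel"
      using kernel_subspace(2)[OF d that] kernel_subspace(3)[OF that d]
      by (metis set_plus_intro2)+
  qed
  then show "f +o kernel = f' +o kernel" by (auto simp: elt_set_plus_def)
qed

lemma embedding_add: "embedding (s + t) = embedding s + embedding t"
proof (intro set_eqI iffI)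
  fix f assume "f \<in> embedding (s + t)"
  then obtain k where "k \<in> kernel" "f = cell_section L0 s + cell_section L0 t + k"
    by (auto simp: embedding_def elt_set_plus_def cell_section_add)
  then have "f = (cell_section L0 s + 0) + (cell_section L0 t + k)" by simp
  then show "f \<in> embedding s + embedding t"
    unfolding embedding_def using kernel_subspace(1) \<open>k \<in> kernel\<close>
    by (metis set_plus_intro set_plus_intro2)
next
  fix f assume "f \<in> embedding s + embedding t"
  then obtain k k' where k: "k \<in> kernel" "k' \<in> kernel"
    and "f = (cell_section L0 s + k) + (cell_section L0 t + k')"
    by (auto simp: embedding_def elt_set_plus_def elim!: set_plus_elim)
  then have "f = cell_section L0 (s + t) + (k + k')" by (simp add: cell_section_add)
  then show "f \<in> embedding (s + t)"
    unfolding embedding_def using kernel_subspace(2)[OF k] by (metis set_plus_intro2)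
qed

lemma embedding_scale: "embedding (c *\<^sub>C t) = coset_scale kernel c (embedding t)"
proof (intro set_eqI iffI)
  fix f assume "f \<in> embedding (c *\<^sub>C t)"
  then obtain k where k: "k \<in> kernel" "f = c *\<^sub>C cell_section L0 t + k"
    by (auto simp: embedding_def elt_set_plus_def cell_section_scale)
  have "cell_section L0 t \<in> embedding t"
    unfolding embedding_def using kernel_subspace(1) by (metis add.right_neutral set_plus_intro2)
  then show "f \<in> coset_scale kernel c (embedding t)"
    unfolding coset_scale_def k(2) using k(1) by (intro set_plus_intro imageI)
next
  fix f assume "f \<in> coset_scale kernel c (embedding t)"
  then obtain k k' where k: "k \<in> kernel" "k' \<in> kernel" "f = c *\<^sub>C (cell_section L0 t + k) + k'"
    by (auto simp: coset_scale_def embedding_def elt_set_plus_def elim!: set_plus_elim)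
  then have "f = cell_section L0 (c *\<^sub>C t) + (c *\<^sub>C k + k')"
    by (simp add: cell_section_scale scaleC_add_right add.assoc)
  moreover have "c *\<^sub>C k + k' \<in> kernel" using k kernel_subspace by blast
  ultimately show "f \<in> embedding (c *\<^sub>C t)"
    unfolding embedding_def by (metis set_plus_intro2)
qed

lemma kernel_diag_image:
  assumes g: "g \<in> GL"
  shows "right_translation (diag_block g) ` kernel = kernel"
proof
  show "right_translation (diag_block g) ` kernel \<subseteq> kernel" using kernel_diag[OF g] by blast
  show "kernel \<subseteq> right_translation (diag_block g) ` kernel"
  proof
    fix f assume f: "f \<in> kernel"
    have "f = right_translation (diag_block g) (right_translation (diag_block (matrix_inv g)) f)"
      by (simp flip: right_translation_mult
          add: diag_block_mult matrix_inv_right[OF g] block_one right_translation_one)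
    then show "f \<in> right_translation (diag_block g) ` kernel"
      using kernel_diag[OF matrix_inv_GL[OF g] f] by blast
  qed
qed

lemma embedding_diag:
  assumes g: "g \<in> GL"
  shows "embedding (\<sigma> g g t) = diag_action right_translation g (embedding t)"
proof -
  let ?g = "right_translation (diag_block g)"
  have "?g ` (cell_section L0 t +o kernel) = ?g (cell_section L0 t) +o ?g ` kernel"
    by (auto simp: elt_set_plus_def image_iff right_translation_add) (metis right_translation_add)+
  also have "\<dots> = ?g (cell_section L0 t) +o kernel" by (simp only: kernel_diag_image[OF g])
  also have "\<dots> = cell_section L0 (\<sigma> g g t) +o kernel"
    using scales_by_GL[OF g] unfolding coset_eq_iff by (simp add: scales_by_def scaleC_one)
  finally show ?thesis by (simp add: embedding_def diag_action_def)
qed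

lemma embedding_zero: "embedding 0 = kernel"
proof -
  have "cell_section L0 0 = 0" using cell_section_scale[of L0 0 0] by simp
  then show ?thesis by (simp add: embedding_def)
qed

lemma inj_embedding: "inj embedding"
proof (rule injI)
  fix s t assume "embedding s = embedding t"
  then have "cell_section L0 s - cell_section L0 t \<in> kernel"
    unfolding embedding_def coset_eq_iff .
  moreover have "cell_section L0 s - cell_section L0 t = cell_section L0 (s - t)"
    using cell_section_add[of L0 "s - t" t] by simp
  ultimately show "s = t" using cell_section_kernel_imp_zero[of "s - t"] by simp
qed

lemma embedding_in_jacquet: "embedding t \<in> twisted_jacquet \<psi> right_translation ind"
  using cell_section_in_ind[OF lattice_mball[OF r0_pos]] by (auto simp: embedding_def twisted_jacquet_def)

lemma iso_embedding:
  "iso_onto_jacquet_submodule \<psi> right_translation ind (\<lambda>g. \<sigma> g g) (range embedding) embedding"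
  unfolding iso_onto_jacquet_submodule_def jacquet_submodule_def
proof (intro conjI ballI allI)
  show "range embedding \<subseteq> twisted_jacquet \<psi> right_translation ind" using embedding_in_jacquet by blast
  show "kernel \<in> range embedding" using embedding_zero by (metis rangeI)
  show "A + B \<in> range embedding" if "A \<in> range embedding" "B \<in> range embedding" for A B
    using that by (auto simp flip: embedding_add)
  show "coset_scale kernel c A \<in> range embedding" if "A \<in> range embedding" for c A
    using that by (auto simp flip: embedding_scale)
  show "diag_action right_translation g A \<in> range embedding" if "g \<in> GL" "A \<in> range embedding" for g A
    using that by (auto simp flip: embedding_diag)
  show "bij_betw embedding UNIV (range embedding)" using inj_embedding by (simp add: bij_betw_def)
qed (simp_all add: embedding_add embedding_scale embedding_diag)

lemma twisted_jacquet_nonzero: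
  "\<exists>A \<in> twisted_jacquet \<psi> right_translation ind. A \<noteq> kernel"
proof -
  obtain t :: "('v, 'w) tensor" where "t \<noteq> 0" using ex_nonzero_tensor by blast
  then have "embedding t \<noteq> kernel" using inj_embedding embedding_zero by (metis injD)
  then show ?thesis using embedding_in_jacquet by blast
qed

end

theorem theorem1p6:
  fixes \<rho>1 :: "'a::nonarch_valued_field ^ 'n ^ 'n \<Rightarrow> 'v::complex_vector \<Rightarrow> 'v"
    and \<rho>2 :: "'a ^ 'n ^ 'n \<Rightarrow> 'w::complex_vector \<Rightarrow> 'w"
    and \<psi>0 :: "'a \<Rightarrow> complex"
  assumes "finite (UNIV :: 'a set) \<or> nonarch_local_field TYPE('a)"
    and "nontrivial_additive_character \<psi>0"
    and "smooth_rep \<rho>1" and "\<exists>v::'v. v \<noteq> 0"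
    and "smooth_rep \<rho>2" and "\<exists>w::'w. w \<noteq> 0"
  shows "(\<exists>W T. iso_onto_jacquet_submodule \<psi>0 right_translation (parabolic_ind \<rho>1 \<rho>2)
                  (\<lambda>g. tensor_map (\<rho>1 g) (\<rho>2 g)) W T) \<and>
         (\<exists>A \<in> twisted_jacquet \<psi>0 right_translation (parabolic_ind \<rho>1 \<rho>2).
            A \<noteq> jacquet_kernel \<psi>0 right_translation (parabolic_ind \<rho>1 \<rho>2))"
proof -
  interpret nonzero_induction_data \<rho>1 \<rho>2 \<psi>0
    by unfold_locales (fact assms)+
  show ?thesis using iso_embedding twisted_jacquet_nonzero by blast
qed

end
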